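(* Let $\mathbb{F}$ be a field and let $C=\bigoplus_p C_p$ be a graded $\mathbb{F}$-vector space with $C_p=0$ for all $p<0$. Let $\{\Delta_n\}_{n\ge 1}$ and $\{\Delta'_n\}_{n\ge 1}$ be two minimal $A_\infty$-coalgebra structures on $C$ such that $(C,\{\Delta_n\}_n)$ and $(C,\{\Delta'_n\}_n)$ are isomorphic as $A_\infty$-coalgebras. Set $k:=\min\{n \mid \Delta_n\neq 0\}$ if this set is non-empty and $k:=+\infty$ otherwise; likewise set $k':=\min\{n \mid \Delta'_n\neq 0\}$ if this set is non-empty and $k':=+\infty$ otherwise. Then $k=k'$, and $$\dim \operatorname{Ker}\bigl(\Delta_m|_{C_p}\bigr)=\dim \operatorname{Ker}\bigl(\Delta'_m|_{C_p}\bigr)$$ for all integers $m\ge 1$ with $m\le k$ and all integers $p\ge 0$.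
   Context: All vector spaces are over the field $\mathbb{F}$, and tensor products of graded maps follow the Koszul sign rule. An $A_\infty$-coalgebra structure on a graded vector space $C$ is a family of linear maps $\Delta_n\colon C\to C^{\otimes n}$ ($n\ge 1$) of degree $n-2$ such that for every $n\ge 1$ $$\sum_{i=1}^n\sum_{j=0}^{n-i}(-1)^{i+j+ij}\bigl(1^{\otimes (n-i-j)}\otimes\Delta_i\otimes 1^{\otimes j}\bigr)\Delta_{n-i+1}=0 .$$ It is minimal if $\Delta_1=0$. Equivalently, writing $s^{-1}C$ for the desuspension, $(s^{-1}C)_p=C_{p+1}$, the maps $d_n=-(s^{-1})^{\otimes n}\circ\Delta_n\circ s\colon s^{-1}C\to (s^{-1}C)^{\otimes n}$ assemble into a degree $-1$ derivation $d=\sum_n d_n$ with $d^2=0$ on the complete tensor algebra $\widehat T(s^{-1}C)=\prod_{n\ge 1}(s^{-1}C)^{\otimes n}$ (product taken in each degree). A morphism of $A_\infty$-coalgebras $f\colon(C,\{\Delta_n\})\to(C',\{\Delta'_n\})$ is a family of linear maps $f_{(k)}\colon C\to (C')^{\otimes k}$, $k\ge 1$, of degree $k-1$, such that the algebra morphism $\widehat T(s^{-1}C)\to\widehat T(s^{-1}C')$ determined by $s^{-1}c\mapsto\sum_{k\ge 1}(s^{-1})^{\otimes k}f_{(k)}(c)$ commutes with the differentials $d$ and $d'$; up to Koszul signs this says that for each $i\ge 1$, $\sum_{p+q+k=i,\ q\ge 1,\ p,k\ge 0}(1^{\otimes p}\otimes\Delta'_q\otimes 1^{\otimes k})f_{(p+k+1)}=\sum_{k_1+\dots+k_\ell=i,\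 \ell,k_j\ge 1}(f_{(k_1)}\otimes\dots\otimes f_{(k_\ell)})\Delta_\ell$. It is an isomorphism if $f_{(1)}$ is an isomorphism. *)

theory Defs
  imports Main "HOL.Vector_Spaces" "HOL-Library.Function_Algebras" "HOL-Library.Extended_Nat"
begin

section \<open>Graded vector spaces\<close>

text \<open>
  A vector space is given by its scalar multiplication (locale \<^locale>\<open>vector_space\<close>); its vectors
  are all elements of the type.  A grading by the integers is an internal direct sum decomposition.
\<close>

locale graded_vector_space = vector_space scale
  for scale :: "'f::field \<Rightarrow> 'c::ab_group_add \<Rightarrow> 'c" +
  fixes C :: "int \<Rightarrow> 'c set"
  assumes subspace_deg: "subspace (C p)"
    and direct_sum: "\<exists>!c. (\<forall>p. c p \<in> C p) \<and> finite {p. c p \<noteq> 0} \<and> x = (\<Sum>p | c p \<noteq> 0. c p)"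

definition hcomp :: "(int \<Rightarrow> 'c::ab_group_add set) \<Rightarrow> 'c \<Rightarrow> int \<Rightarrow> 'c" where
  "hcomp C x = (THE c. (\<forall>p. c p \<in> C p) \<and> finite {p. c p \<noteq> 0} \<and> x = (\<Sum>p | c p \<noteq> 0. c p))"

text \<open>
  The linear map which multiplies a homogeneous vector of degree \<open>p\<close> by \<open>(-1)\<close> to the power \<open>d * p\<close>
  (see \<open>twist_homogeneous\<close> below): the Koszul sign for moving a map of degree \<open>d\<close> past the vector.
\<close>

definition twist :: "(int \<Rightarrow> 'c::ab_group_add set) \<Rightarrow> int \<Rightarrow> 'c \<Rightarrow> 'c" where
  "twist C d x = (\<Sum>p | hcomp C x p \<noteq> 0. if even (d * p) then hcomp C x p else - hcomp C x p)"

lemma (in graded_vector_space) hcomp_homogeneous: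
  assumes "x \<in> C p"
  shows "hcomp C x = (\<lambda>q. if q = p then x else 0)"
  unfolding hcomp_def
proof (rule the1_equality[OF direct_sum])
  have "(\<Sum>q | (if q = p then x else 0) \<noteq> 0. if q = p then x else 0) = x"
    by (cases "x = 0") auto
  moreover have "finite {q. (if q = p then x else 0) \<noteq> 0}"
    by (rule finite_subset[of _ "{p}"]) auto
  ultimately show "(\<forall>q. (if q = p then x else 0) \<in> C q) \<and> finite {q. (if q = p then x else 0) \<noteq> 0} \<and>
      x = (\<Sum>q | (if q = p then x else 0) \<noteq> 0. if q = p then x else 0)"
    using assms subspace_0[OF subspace_deg] by auto
qed

lemma (in graded_vector_space) twist_homogeneous:
  assumes "x \<in> C p"
  shows "twist C d x = (if even (d * p) then x else - x)"
proof -
  have "{q. hcomp C x q \<noteq> 0} = (if x = 0 then {} else {p})"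
    by (auto simp: hcomp_homogeneous[OF assms])
  then show ?thesis by (simp add: twist_def hcomp_homogeneous[OF assms])
qed

lemma (in graded_vector_space) hcomp:
  shows hcomp_in: "hcomp C x p \<in> C p"
    and finite_hcomp: "finite {p. hcomp C x p \<noteq> 0}"
    and sum_hcomp: "(\<Sum>p | hcomp C x p \<noteq> 0. hcomp C x p) = x"
  using theI'[OF direct_sum[of x]] unfolding hcomp_def[symmetric] by auto

lemma (in graded_vector_space) hcomp_unique:
  assumes "\<And>p. c p \<in> C p" "finite A" "\<And>p. p \<notin> A \<Longrightarrow> c p = 0" "x = (\<Sum>p\<in>A. c p)"
  shows "hcomp C x = c"
  unfolding hcomp_def
proof (rule the1_equality[OF direct_sum])
  have "{p. c p \<noteq> 0} \<subseteq> A" using assms(3) by auto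
  moreover have "(\<Sum>p\<in>A. c p) = (\<Sum>p | c p \<noteq> 0. c p)"
    using assms(3) by (intro sum.mono_neutral_right assms(2)) auto
  ultimately show "(\<forall>p. c p \<in> C p) \<and> finite {p. c p \<noteq> 0} \<and> x = (\<Sum>p | c p \<noteq> 0. c p)"
    using assms finite_subset by auto
qed

lemma (in graded_vector_space) sum_hcomp_superset:
  assumes "finite A" "{p. hcomp C x p \<noteq> 0} \<subseteq> A"
  shows "x = (\<Sum>p\<in>A. hcomp C x p)"
  by (subst sum_hcomp[of x, symmetric], rule sum.mono_neutral_left) (use assms in auto)

lemma (in graded_vector_space) hcomp_add: "hcomp C (x + y) = (\<lambda>p. hcomp C x p + hcomp C y p)"
proof (rule hcomp_unique)
  let ?A = "{p. hcomp C x p \<noteq> 0} \<union> {p. hcomp C y p \<noteq> 0}"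
  show "finite ?A" using finite_hcomp by auto
  then show "x + y = (\<Sum>p\<in>?A. hcomp C x p + hcomp C y p)"
    using sum_hcomp_superset[of ?A x] sum_hcomp_superset[of ?A y] by (simp add: sum.distrib)
qed (auto intro!: subspace_add[OF subspace_deg] hcomp_in)

lemma (in graded_vector_space) hcomp_scale: "hcomp C (scale a x) = (\<lambda>p. scale a (hcomp C x p))"
  by (rule hcomp_unique[where A = "{p. hcomp C x p \<noteq> 0}"])
    (auto intro!: subspace_scale[OF subspace_deg] hcomp_in finite_hcomp simp: scale_sum_right[symmetric] sum_hcomp)

lemma (in graded_vector_space) twist_superset:
  assumes "finite A" "{p. hcomp C x p \<noteq> 0} \<subseteq> A"
  shows "twist C d x = (\<Sum>p\<in>A. if even (d * p) then hcomp C x p else - hcomp C x p)"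
  unfolding twist_def by (rule sum.mono_neutral_left) (use assms in auto)

lemma (in graded_vector_space) linear_twist: "Vector_Spaces.linear scale scale (twist C d)"
proof (unfold_locales, goal_cases)
  case (1 x y)
  let ?A = "{p. hcomp C x p \<noteq> 0} \<union> {p. hcomp C y p \<noteq> 0}"
  have "finite ?A" using finite_hcomp by auto
  then show ?case
    by (subst (1 2 3) twist_superset[of ?A])
      (auto simp: hcomp_add sum.distrib[symmetric] intro!: sum.cong)
next
  case (2 a x)
  have "finite {p. hcomp C x p \<noteq> 0}" by (rule finite_hcomp)
  then show ?case
    by (subst (1 2) twist_superset[of "{p. hcomp C x p \<noteq> 0}"])
      (auto simp: hcomp_scale scale_sum_right intro!: sum.cong)
qed

text \<open>
  The desuspension has the same underlying vector space, with shifted grading; thus the maps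
  \<open>s\<close> and its inverse are the identity on vectors, of degrees \<open>1\<close> and \<open>-1\<close>.
\<close>

definition desusp :: "(int \<Rightarrow> 'c set) \<Rightarrow> int \<Rightarrow> 'c set" where
  "desusp C p = C (p + 1)"

text \<open>The dimension as a cardinal number (the library's \<open>dim\<close> is \<open>0\<close> in infinite dimension).\<close>

definition cdim :: "('f::field \<Rightarrow> 'c::ab_group_add \<Rightarrow> 'c) \<Rightarrow> 'c set \<Rightarrow> 'c rel" where
  "cdim scale S = card_of (SOME B. \<not> module.dependent scale B \<and> module.span scale B = S)"


section \<open>Tensor powers\<close>

text \<open>
  The tensor \<open>x\<^sub>1 \<otimes> \<dots> \<otimes> x\<^sub>n\<close> is represented by evaluation of multilinear forms at \<open>(x\<^sub>1, \<dots>, x\<^sub>n)\<close>, and the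
  \<open>n\<close>-th tensor power is the linear span of these evaluations.  Over a field this is a model of
  the tensor power: see the universal property \<open>tensor_universal_property\<close> below.  A function on
  lists is multilinear if its restriction to lists of each length is, so all tensor powers live
  in one type.
\<close>

type_synonym ('f, 'c) tensor = "('c list \<Rightarrow> 'f) \<Rightarrow> 'f"

definition multilinear ::
    "('f::field \<Rightarrow> 'c::ab_group_add \<Rightarrow> 'c) \<Rightarrow> ('f \<Rightarrow> 'd::ab_group_add \<Rightarrow> 'd) \<Rightarrow> ('c list \<Rightarrow> 'd) \<Rightarrow> bool" where
  "multilinear scale scale' g \<longleftrightarrow> (\<forall>xs ys. Vector_Spaces.linear scale scale' (\<lambda>x. g (xs @ x # ys)))"

abbreviation form :: "('f::field \<Rightarrow> 'c::ab_group_add \<Rightarrow> 'c) \<Rightarrow> ('c list \<Rightarrow> 'f) \<Rightarrow> bool" where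
  "form scale \<equiv> multilinear scale (*)"

definition tens :: "('f::field \<Rightarrow> 'c::ab_group_add \<Rightarrow> 'c) \<Rightarrow> 'c list \<Rightarrow> ('f, 'c) tensor" where
  "tens scale xs = (\<lambda>\<phi>. if form scale \<phi> then \<phi> xs else 0)"

definition tscale :: "'f::field \<Rightarrow> ('f, 'c) tensor \<Rightarrow> ('f, 'c) tensor" where
  "tscale a t = (\<lambda>\<phi>. a * t \<phi>)"

definition tmult :: "('f::field \<Rightarrow> 'c::ab_group_add \<Rightarrow> 'c) \<Rightarrow>
    ('f, 'c) tensor \<Rightarrow> ('f, 'c) tensor \<Rightarrow> ('f, 'c) tensor" where
  "tmult scale t u = (\<lambda>\<phi>. if form scale \<phi> then t (\<lambda>xs. u (\<lambda>ys. \<phi> (xs @ ys))) else 0)"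

definition tpow :: "('f::field \<Rightarrow> 'c::ab_group_add \<Rightarrow> 'c) \<Rightarrow> nat \<Rightarrow> ('f, 'c) tensor set" where
  "tpow scale n = module.span tscale {tens scale xs | xs. length xs = n}"

definition tpow_deg :: "('f::field \<Rightarrow> 'c::ab_group_add \<Rightarrow> 'c) \<Rightarrow> (int \<Rightarrow> 'c set) \<Rightarrow>
    nat \<Rightarrow> int \<Rightarrow> ('f, 'c) tensor set" where
  "tpow_deg scale C n q = module.span tscale
     {tens scale xs | xs ps. length xs = n \<and> list_all2 (\<lambda>x p. x \<in> C p) xs ps \<and> sum_list ps = q}"

lemma vector_space_tscale: "vector_space (tscale :: 'f::field \<Rightarrow> ('f, 'c) tensor \<Rightarrow> _)"
  by unfold_locales (auto simp: tscale_def algebra_simps fun_eq_iff)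

lemma linear_iff_vs:
  assumes "vector_space s" "vector_space s'"
  shows "Vector_Spaces.linear s s' f \<longleftrightarrow>
    (\<forall>x y. f (x + y) = f x + f y) \<and> (\<forall>a x. f (s a x) = s' a (f x))"
  using assms
  by (auto simp: Vector_Spaces.linear_def module_hom_def module_hom_axioms_def vector_space_def module_def)

lemma form_iff:
  assumes "vector_space scale"
  shows "form scale \<phi> \<longleftrightarrow> (\<forall>xs ys x y. \<phi> (xs @ (x + y) # ys) = \<phi> (xs @ x # ys) + \<phi> (xs @ y # ys)) \<and>
     (\<forall>xs ys a x. \<phi> (xs @ scale a x # ys) = a * \<phi> (xs @ x # ys))"
proof -
  have "vector_space ((*) :: 'a \<Rightarrow> 'a \<Rightarrow> 'a)" by unfold_locales (auto simp: algebra_simps)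
  from linear_iff_vs[OF assms this] show ?thesis by (auto simp: multilinear_def)
qed

lemma tmult_tens:
  assumes "vector_space scale"
  shows "tmult scale (tens scale xs) (tens scale ys) = tens scale (xs @ ys)"
proof
  fix \<phi>
  show "tmult scale (tens scale xs) (tens scale ys) \<phi> = tens scale (xs @ ys) \<phi>"
  proof (cases "form scale \<phi>")
    case \<phi>: True
    have 1: "form scale (\<lambda>w. \<phi> (v @ w))" for v
      using \<phi> unfolding form_iff[OF assms] by (auto simp flip: append_assoc)
    have 2: "form scale (\<lambda>v. \<phi> (v @ ys))"
      using \<phi> unfolding form_iff[OF assms] by auto
    show ?thesis using \<phi> 1 2 by (simp add: tmult_def tens_def)
  qed (simp add: tmult_def tens_def)
qed

text \<open>
  Multilinear maps from lists of all lengths correspond to linear maps from the tensor algebra.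
  Uniqueness on each tensor power is immediate, since tensor powers are spanned by tensors.
\<close>

lemma tensor_universal_property:
  assumes "vector_space scale" and "vector_space scale'" and g: "multilinear scale scale' g"
  shows "\<exists>h. Vector_Spaces.linear tscale scale' h \<and> (\<forall>xs. h (tens scale xs) = g xs)"
proof -
  interpret V: vector_space scale by fact
  interpret W: vector_space scale' by fact
  interpret T: vector_space "tscale :: 'a \<Rightarrow> ('a, 'b) tensor \<Rightarrow> _" by (rule vector_space_tscale)
  interpret TW: vector_space_pair "tscale :: 'a \<Rightarrow> ('a, 'b) tensor \<Rightarrow> _" scale' ..
  interpret F: vector_space "(*) :: 'a \<Rightarrow> 'a \<Rightarrow> 'a" by unfold_locales (auto simp: algebra_simps)
  interpret WF: vector_space_pair scale' "(*) :: 'a \<Rightarrow> 'a \<Rightarrow> 'a" ..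
  have separate: "w = 0" if "\<And>l. Vector_Spaces.linear scale' (*) l \<Longrightarrow> l w = 0" for w
  proof (rule ccontr)
    assume "w \<noteq> 0"
    then have "W.independent {w}" by simp
    from WF.linear_independent_extend[OF this, of "\<lambda>_. 1"] that show False by fastforce
  qed
  obtain B where B: "B \<subseteq> range (tens scale)" "T.independent B" "range (tens scale) \<subseteq> T.span B"
    by (rule T.maximal_independent_subset)
  define h where "h = TW.construct B (\<lambda>b. g (inv_into UNIV (tens scale) b))"
  have h: "Vector_Spaces.linear tscale scale' h"
    unfolding h_def by (rule TW.linear_construct[OF B(2)])
  interpret h: Vector_Spaces.linear tscale scale' h by (rule h)
  have key: "l (h t) = t (\<lambda>xs. l (g xs))" if "t \<in> T.span B" and l: "Vector_Spaces.linear scale' (*) l" for t l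
  proof -
    interpret l: Vector_Spaces.linear scale' "(*)" l by (rule l)
    have form: "form scale (\<lambda>xs. l (g xs))"
      using g Vector_Spaces.linear_compose[OF _ l] unfolding multilinear_def by (fastforce simp: o_def)
    from that(1) show ?thesis
    proof (induction rule: T.span_induct_alt)
      case base
      show ?case using h.zero l.zero by (simp add: zero_fun_def)
    next
      case (step c x y)
      from step.hyps(1) B(1) have "tens scale (inv_into UNIV (tens scale) x) = x"
        by (intro f_inv_into_f) auto
      then have "x (\<lambda>xs. l (g xs)) = l (g (inv_into UNIV (tens scale) x))"
        using form by (metis (no_types, lifting) tens_def)
      also have "\<dots> = l (h x)"
        unfolding h_def using TW.construct_basis[OF B(2) step.hyps(1)] by simp
      finally have x: "x (\<lambda>xs. l (g xs)) = l (h x)" .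
      have "l (h (tscale c x + y)) = c * l (h x) + l (h y)"
        by (simp only: h.add h.scale l.add l.scale)
      then show ?case
        unfolding step.IH x[symmetric] by (simp add: tscale_def plus_fun_def)
    qed
  qed
  have "h (tens scale xs) = g xs" for xs
  proof -
    have "h (tens scale xs) - g xs = 0"
    proof (rule separate)
      fix l assume l: "Vector_Spaces.linear scale' (*) l"
      interpret l: Vector_Spaces.linear scale' "(*)" l by (rule l)
      have "form scale (\<lambda>xs. l (g xs))"
        using g Vector_Spaces.linear_compose[OF _ l] unfolding multilinear_def by (fastforce simp: o_def)
      with key[OF _ l, of "tens scale xs"] B(3) show "l (h (tens scale xs) - g xs) = 0"
        by (auto simp: l.diff tens_def)
    qed
    then show ?thesis by simp
  qed
  with h show ?thesis by blast
qed

lemma linear_on_forms: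
  assumes V: "vector_space scale" and t: "t \<in> module.span tscale (range (tens scale))"
  shows "\<not> form scale \<phi> \<Longrightarrow> t \<phi> = 0"
    and "form scale \<phi> \<Longrightarrow> form scale \<psi> \<Longrightarrow> t (\<lambda>xs. \<phi> xs + \<psi> xs) = t \<phi> + t \<psi>"
    and "form scale \<phi> \<Longrightarrow> t (\<lambda>xs. a * \<phi> xs) = a * t \<phi>"
proof -
  interpret T: vector_space "tscale :: 'a \<Rightarrow> ('a, 'b) tensor \<Rightarrow> _" by (rule vector_space_tscale)
  let ?P = "\<lambda>t. (\<forall>\<phi>. \<not> form scale \<phi> \<longrightarrow> t \<phi> = 0) \<and>
      (\<forall>\<phi> \<psi>. form scale \<phi> \<longrightarrow> form scale \<psi> \<longrightarrow> t (\<lambda>xs. \<phi> xs + \<psi> xs) = t \<phi> + t \<psi>) \<and>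
      (\<forall>\<phi> a. form scale \<phi> \<longrightarrow> t (\<lambda>xs. a * \<phi> xs) = a * t \<phi>)"
  have 1: "form scale (\<lambda>xs. \<phi> xs + \<psi> xs)" if "form scale \<phi>" "form scale \<psi>" for \<phi> \<psi> :: "'b list \<Rightarrow> 'a"
    using that unfolding form_iff[OF V] by (simp add: algebra_simps)
  have 2: "form scale (\<lambda>xs. a * \<phi> xs)" if "form scale \<phi>" for a and \<phi> :: "'b list \<Rightarrow> 'a"
    using that unfolding form_iff[OF V] by (simp add: algebra_simps)
  from t have "?P t"
  proof (induction rule: T.span_induct_alt)
    case (step c x y)
    then obtain xs where "x = tens scale xs" by auto
    with 1 2 have "?P x" by (simp add: tens_def)
    with step.IH show ?case by (simp add: tscale_def algebra_simps)
  qed simp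
  then show "\<not> form scale \<phi> \<Longrightarrow> t \<phi> = 0"
    and "form scale \<phi> \<Longrightarrow> form scale \<psi> \<Longrightarrow> t (\<lambda>xs. \<phi> xs + \<psi> xs) = t \<phi> + t \<psi>"
    and "form scale \<phi> \<Longrightarrow> t (\<lambda>xs. a * \<phi> xs) = a * t \<phi>"
    by blast+
qed

lemma form_shift:
  assumes V: "vector_space scale" and \<phi>: "form scale \<phi>"
  shows "form scale (\<lambda>w. \<phi> (v @ w))"
  using \<phi> unfolding form_iff[OF V] by (auto simp flip: append_assoc)

lemma form_eval_right:
  assumes V: "vector_space scale" and \<phi>: "form scale \<phi>"
    and u: "u \<in> module.span tscale (range (tens scale))"
  shows "form scale (\<lambda>v. u (\<lambda>w. \<phi> (v @ w)))"
proof -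
  have "\<phi> ((xs @ (x + y) # ys) @ w) = \<phi> ((xs @ x # ys) @ w) + \<phi> ((xs @ y # ys) @ w)"
    "\<phi> ((xs @ scale a x # ys) @ w) = a * \<phi> ((xs @ x # ys) @ w)" for xs x y ys w a
    using \<phi> unfolding form_iff[OF V] by auto
  then show ?thesis
    unfolding form_iff[OF V]
    by (auto simp only: linear_on_forms(2,3)[OF V u] form_shift[OF V \<phi>])
qed

lemma tmult_span:
  assumes V: "vector_space scale"
    and t: "t \<in> module.span tscale (range (tens scale))" and u: "u \<in> module.span tscale (range (tens scale))"
  shows "tmult scale t u \<in> module.span tscale (range (tens scale))"
proof -
  interpret T: vector_space "tscale :: 'a \<Rightarrow> ('a, 'b) tensor \<Rightarrow> _" by (rule vector_space_tscale)
  let ?r = "\<lambda>xs (u :: ('a, 'b) tensor) \<phi>. if form scale \<phi> then u (\<lambda>w. \<phi> (xs @ w)) else 0"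
  have right: "?r xs u \<in> T.span (range (tens scale))" for xs
    using u
  proof (induction rule: T.span_induct_alt)
    case base
    have "?r xs 0 = 0" by auto
    then show ?case by (simp only: T.span_zero)
  next
    case (step c x y)
    then obtain ys where ys: "x = tens scale ys" by auto
    have "?r xs x = tens scale (xs @ ys)"
      using form_shift[OF V] by (auto simp: ys tens_def)
    moreover have "?r xs (tscale c x + y) = tscale c (?r xs x) + ?r xs y"
      by (auto simp: tscale_def)
    ultimately show ?case
      using step.IH by (simp only:) (intro T.span_add T.span_scale, auto intro: T.span_base)
  qed
  from t show ?thesis
  proof (induction rule: T.span_induct_alt)
    case base
    have "tmult scale 0 u = 0" by (auto simp: tmult_def)
    then show ?case by (simp only: T.span_zero)
  next
    case (step c x y)
    then obtain xs where xs: "x = tens scale xs" by auto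
    have "tmult scale x u = ?r xs u"
      using form_eval_right[OF V _ u] by (auto simp: xs tmult_def tens_def)
    moreover have "tmult scale (tscale c x + y) u = tscale c (tmult scale x u) + tmult scale y u"
      by (auto simp: tmult_def tscale_def)
    ultimately show ?case
      using step.IH right by (simp only:) (intro T.span_add T.span_scale, auto)
  qed
qed

text \<open>
  A list \<open>[(d\<^sub>1, g\<^sub>1), \<dots>, (d\<^sub>n, g\<^sub>n)]\<close> consists of linear maps \<open>g\<^sub>i\<close> of degree \<open>d\<^sub>i\<close> from a graded space
  to tensor powers.  \<open>kmap\<close> is \<open>g\<^sub>1 \<otimes> \<dots> \<otimes> g\<^sub>n\<close> with the Koszul sign: on a tensor of homogeneous
  vectors it gives \<open>g\<^sub>1 x\<^sub>1 \<otimes> \<dots> \<otimes> g\<^sub>n x\<^sub>n\<close> times \<open>(-1)\<close> to the power of the sum of all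
  \<open>d\<^sub>j * deg x\<^sub>i\<close> with \<open>i < j\<close>.  It is well defined by \<open>kmap_tens\<close> below.
\<close>

fun ktensor :: "(int \<Rightarrow> 'c::ab_group_add set) \<Rightarrow> ('f::field \<Rightarrow> 'd::ab_group_add \<Rightarrow> 'd) \<Rightarrow>
    (int \<times> ('c \<Rightarrow> ('f, 'd) tensor)) list \<Rightarrow> 'c list \<Rightarrow> ('f, 'd) tensor" where
  "ktensor C scale' [] [] = tens scale' []"
| "ktensor C scale' ((d, g) # gs) (x # xs) =
     tmult scale' (g (twist C (sum_list (map fst gs)) x)) (ktensor C scale' gs xs)"
| "ktensor C scale' _ _ = 0"

definition kmap :: "(int \<Rightarrow> 'c::ab_group_add set) \<Rightarrow> ('f::field \<Rightarrow> 'd::ab_group_add \<Rightarrow> 'd) \<Rightarrow>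
    (int \<times> ('c \<Rightarrow> ('f, 'd) tensor)) list \<Rightarrow> ('f, 'c) tensor \<Rightarrow> ('f, 'd) tensor" where
  "kmap C scale' gs t = (\<lambda>\<phi>. if form scale' \<phi> then t (\<lambda>xs. ktensor C scale' gs xs \<phi>) else 0)"

lemma ktensor_span:
  assumes V: "vector_space scale'"
    and gs: "\<forall>(d, g) \<in> set gs. range g \<subseteq> module.span tscale (range (tens scale'))"
  shows "ktensor C scale' gs xs \<in> module.span tscale (range (tens scale'))"
proof -
  interpret T: vector_space "tscale :: 'a \<Rightarrow> ('a, 'b) tensor \<Rightarrow> _" by (rule vector_space_tscale)
  show ?thesis
    using gs V
  proof (induction C scale' gs xs rule: ktensor.induct)
    case (2 C scale' d g gs x xs)
    then show ?case by (auto intro!: tmult_span)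
  qed (auto intro: T.span_base T.span_zero)
qed

lemma form_ktensor:
  assumes V: "vector_space scale" "vector_space scale'" "graded_vector_space scale C"
    and gs: "\<forall>(d, g) \<in> set gs. Vector_Spaces.linear scale tscale g \<and> range g \<subseteq> module.span tscale (range (tens scale'))"
    and \<phi>: "form scale' \<phi>"
  shows "form scale (\<lambda>xs. ktensor C scale' gs xs \<phi>)"
  using gs \<phi>
proof (induction gs arbitrary: \<phi>)
  case Nil
  have "ktensor C scale' [] (xs @ x # ys) = 0" for xs x ys by (cases xs) auto
  then show ?case unfolding form_iff[OF V(1)] by simp
next
  case (Cons dg gs)
  obtain d g where dg: "dg = (d, g)" by (cases dg)
  interpret G: graded_vector_space scale C by fact
  let ?K = "ktensor C scale' gs"
  let ?t = "\<lambda>x. g (twist C (sum_list (map fst gs)) x)"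
  have "Vector_Spaces.linear scale tscale ?t"
    using Vector_Spaces.linear_compose[OF G.linear_twist, of tscale g] Cons.prems(1)
    by (auto simp: dg o_def)
  then have t: "?t (x + y) = ?t x + ?t y" "?t (scale a x) = tscale a (?t x)" for x y a
    by (auto simp only: linear_iff_vs[OF V(1) vector_space_tscale])
  have t_span: "?t z \<in> module.span tscale (range (tens scale'))" for z
    using Cons.prems(1) by (auto simp: dg)
  have K: "form scale (\<lambda>xs. ?K xs \<psi>)" if "form scale' \<psi>" for \<psi>
    using Cons.IH Cons.prems(1) that by auto
  have K_span: "?K xs \<in> module.span tscale (range (tens scale'))" for xs
    using Cons.prems(1) by (intro ktensor_span[OF V(2)]) fastforce
  have KA: "form scale' (\<lambda>v. ?K xs (\<lambda>w. \<phi> (v @ w)))" for xs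
    by (rule form_eval_right[OF V(2) Cons.prems(2) K_span])
  have K_add: "?K (xs @ (x + y) # ys) (\<lambda>w. \<phi> (v @ w)) =
      ?K (xs @ x # ys) (\<lambda>w. \<phi> (v @ w)) + ?K (xs @ y # ys) (\<lambda>w. \<phi> (v @ w))"
    and K_scale: "?K (xs @ scale a x # ys) (\<lambda>w. \<phi> (v @ w)) = a * ?K (xs @ x # ys) (\<lambda>w. \<phi> (v @ w))"
    for xs x y ys v a
    using K[OF form_shift[OF V(2) Cons.prems(2)]] unfolding form_iff[OF V(1)] by blast+
  show ?case
    unfolding form_iff[OF V(1)]
  proof (intro conjI allI, goal_cases)
    case (1 xs ys x y)
    show ?case
    proof (cases xs)
      case Nil
      then show ?thesis using Cons.prems(2) by (simp only: append_Nil dg ktensor.simps t) (simp add: tmult_def)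
    next
      case (Cons z zs)
      then show ?thesis
        using \<open>form scale' \<phi>\<close>
        by (simp add: dg tmult_def K_add linear_on_forms(2)[OF V(2) t_span KA KA])
    qed
  next
    case (2 xs ys a x)
    show ?case
    proof (cases xs)
      case Nil
      then show ?thesis using Cons.prems(2) by (simp only: append_Nil dg ktensor.simps t) (simp add: tmult_def tscale_def)
    next
      case (Cons z zs)
      then show ?thesis
        using \<open>form scale' \<phi>\<close>
        by (simp add: dg tmult_def K_scale linear_on_forms(3)[OF V(2) t_span KA])
    qed
  qed
qed

lemma kmap_tens:
  assumes V: "vector_space scale" "vector_space scale'" "graded_vector_space scale C"
    and gs: "\<forall>(d, g) \<in> set gs. Vector_Spaces.linear scale tscale g \<and> range g \<subseteq> module.span tscale (range (tens scale'))"
  shows "kmap C scale' gs (tens scale xs) = ktensor C scale' gs xs"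
proof
  fix \<phi>
  have "ktensor C scale' gs xs \<in> module.span tscale (range (tens scale'))"
    using gs by (intro ktensor_span[OF V(2)]) fastforce
  then show "kmap C scale' gs (tens scale xs) \<phi> = ktensor C scale' gs xs \<phi>"
    using form_ktensor[OF V gs] linear_on_forms(1)[OF V(2)] by (simp add: kmap_def tens_def)
qed

abbreviation ident :: "('f::field \<Rightarrow> 'c::ab_group_add \<Rightarrow> 'c) \<Rightarrow> int \<times> ('c \<Rightarrow> ('f, 'c) tensor)" where
  "ident scale \<equiv> (0, \<lambda>x. tens scale [x])"

abbreviation insert_map :: "(int \<Rightarrow> 'c::ab_group_add set) \<Rightarrow> ('f::field \<Rightarrow> 'c \<Rightarrow> 'c) \<Rightarrow>
    nat \<Rightarrow> int \<times> ('c \<Rightarrow> ('f, 'c) tensor) \<Rightarrow> nat \<Rightarrow> ('f, 'c) tensor \<Rightarrow> ('f, 'c) tensor" where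
  "insert_map C scale a g b \<equiv> kmap C scale (replicate a (ident scale) @ [g] @ replicate b (ident scale))"

definition degree_map :: "('f::field \<Rightarrow> 'c::ab_group_add \<Rightarrow> 'c) \<Rightarrow> (int \<Rightarrow> 'c set) \<Rightarrow>
    ('f \<Rightarrow> 'd::ab_group_add \<Rightarrow> 'd) \<Rightarrow> (int \<Rightarrow> 'd set) \<Rightarrow> nat \<Rightarrow> int \<Rightarrow> ('c \<Rightarrow> ('f, 'd) tensor) \<Rightarrow> bool" where
  "degree_map scale C scale' C' n d g \<longleftrightarrow>
     Vector_Spaces.linear scale tscale g \<and> (\<forall>p. \<forall>x \<in> C p. g x \<in> tpow_deg scale' C' n (p + d))"


section \<open>\<open>A\<^sub>\<infinity>\<close>-coalgebras\<close>

text \<open>Families are indexed by natural numbers; the index \<open>0\<close> is always ignored.\<close>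

definition ainf_coalgebra :: "('f::field \<Rightarrow> 'c::ab_group_add \<Rightarrow> 'c) \<Rightarrow> (int \<Rightarrow> 'c set) \<Rightarrow>
    (nat \<Rightarrow> 'c \<Rightarrow> ('f, 'c) tensor) \<Rightarrow> bool" where
  "ainf_coalgebra scale C \<Delta> \<longleftrightarrow> graded_vector_space scale C \<and>
     (\<forall>n\<ge>1. degree_map scale C scale C n (int n - 2) (\<Delta> n)) \<and>
     (\<forall>n\<ge>1. \<forall>x. (\<Sum>i=1..n. \<Sum>j=0..n-i. tscale ((-1) ^ (i + j + i * j))
        (insert_map C scale (n - i - j) (int i - 2, \<Delta> i) j (\<Delta> (n - i + 1) x))) = 0)"

definition minimal :: "(nat \<Rightarrow> 'c \<Rightarrow> ('f::field, 'c) tensor) \<Rightarrow> bool" where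
  "minimal \<Delta> \<longleftrightarrow> \<Delta> 1 = (\<lambda>x. 0)"

definition desusp_map :: "(int \<Rightarrow> 'c::ab_group_add set) \<Rightarrow> ('f::field \<Rightarrow> 'c \<Rightarrow> 'c) \<Rightarrow>
    nat \<Rightarrow> ('f, 'c) tensor \<Rightarrow> ('f, 'c) tensor" where
  "desusp_map C scale n = kmap C scale (replicate n (-1, \<lambda>x. tens scale [x]))"

text \<open>
  The degree \<open>p\<close> part of the complete tensor algebra on a graded space \<open>V\<close>: sequences whose
  \<open>n\<close>-th entry, for \<open>n \<ge> 1\<close>, is in the degree \<open>p\<close> part of the \<open>n\<close>-th tensor power.
\<close>

definition complete_tensor_deg :: "('f::field \<Rightarrow> 'c::ab_group_add \<Rightarrow> 'c) \<Rightarrow> (int \<Rightarrow> 'c set) \<Rightarrow>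
    int \<Rightarrow> (nat \<Rightarrow> ('f, 'c) tensor) set" where
  "complete_tensor_deg scale V p = {t. t 0 = 0 \<and> (\<forall>n\<ge>1. t n \<in> tpow_deg scale V n p)}"

text \<open>
  The degree \<open>-1\<close> derivation of the complete tensor algebra determined by the components
  \<open>\<delta> n\<close> from \<open>V\<close> to its \<open>n\<close>-th tensor power.  By the Leibniz rule its restriction to the \<open>m\<close>-th
  tensor power is the sum of all \<open>1\<^sup>a \<otimes> \<delta> n \<otimes> 1\<^sup>b\<close> with \<open>a + 1 + b = m\<close>, which lands in tensor
  power \<open>m + n - 1\<close>.
\<close>

definition derivation_ext :: "('f::field \<Rightarrow> 'c::ab_group_add \<Rightarrow> 'c) \<Rightarrow> (int \<Rightarrow> 'c set) \<Rightarrow>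
    (nat \<Rightarrow> 'c \<Rightarrow> ('f, 'c) tensor) \<Rightarrow> (nat \<Rightarrow> ('f, 'c) tensor) \<Rightarrow> nat \<Rightarrow> ('f, 'c) tensor" where
  "derivation_ext scale V \<delta> t = (\<lambda>N. \<Sum>m=1..N. \<Sum>b<m.
     insert_map V scale (m - 1 - b) (-1, \<delta> (N - m + 1)) b (t m))"

text \<open>
  The algebra morphism determined by the degree \<open>0\<close> map on generators \<open>v \<mapsto> \<Sum>k\<ge>1. F k v\<close>;
  on the \<open>m\<close>-th tensor power it is the sum of all \<open>F k\<^sub>1 \<otimes> \<dots> \<otimes> F k\<^sub>m\<close>.
\<close>

definition algebra_ext :: "(int \<Rightarrow> 'c::ab_group_add set) \<Rightarrow> ('f::field \<Rightarrow> 'd::ab_group_add \<Rightarrow> 'd) \<Rightarrow>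
    (nat \<Rightarrow> 'c \<Rightarrow> ('f, 'd) tensor) \<Rightarrow> (nat \<Rightarrow> ('f, 'c) tensor) \<Rightarrow> nat \<Rightarrow> ('f, 'd) tensor" where
  "algebra_ext V scale' F t = (\<lambda>N. \<Sum>m=1..N.
     \<Sum>ks | length ks = m \<and> (\<forall>k\<in>set ks. 1 \<le> k) \<and> sum_list ks = N.
       kmap V scale' (map (\<lambda>k. (0, F k)) ks) (t m))"

definition ainf_differential :: "('f::field \<Rightarrow> 'c::ab_group_add \<Rightarrow> 'c) \<Rightarrow> (int \<Rightarrow> 'c set) \<Rightarrow>
    (nat \<Rightarrow> 'c \<Rightarrow> ('f, 'c) tensor) \<Rightarrow> (nat \<Rightarrow> ('f, 'c) tensor) \<Rightarrow> nat \<Rightarrow> ('f, 'c) tensor" where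
  "ainf_differential scale C \<Delta> =
     derivation_ext scale (desusp C) (\<lambda>n x. - desusp_map C scale n (\<Delta> n x))"

definition ainf_morphism :: "('f::field \<Rightarrow> 'c::ab_group_add \<Rightarrow> 'c) \<Rightarrow> (int \<Rightarrow> 'c set) \<Rightarrow>
    (nat \<Rightarrow> 'c \<Rightarrow> ('f, 'c) tensor) \<Rightarrow> ('f \<Rightarrow> 'd::ab_group_add \<Rightarrow> 'd) \<Rightarrow> (int \<Rightarrow> 'd set) \<Rightarrow>
    (nat \<Rightarrow> 'd \<Rightarrow> ('f, 'd) tensor) \<Rightarrow> (nat \<Rightarrow> 'c \<Rightarrow> ('f, 'd) tensor) \<Rightarrow> bool" where
  "ainf_morphism scale C \<Delta> scale' C' \<Delta>' f \<longleftrightarrow>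
     (\<forall>k\<ge>1. degree_map scale C scale' C' k (int k - 1) (f k)) \<and>
     (let F = algebra_ext (desusp C) scale' (\<lambda>k x. desusp_map C' scale' k (f k x)) in
       \<forall>p. \<forall>t \<in> complete_tensor_deg scale (desusp C) p.
         F (ainf_differential scale C \<Delta> t) = ainf_differential scale' C' \<Delta>' (F t))"

definition ainf_isomorphism :: "('f::field \<Rightarrow> 'c::ab_group_add \<Rightarrow> 'c) \<Rightarrow> (int \<Rightarrow> 'c set) \<Rightarrow>
    (nat \<Rightarrow> 'c \<Rightarrow> ('f, 'c) tensor) \<Rightarrow> ('f \<Rightarrow> 'd::ab_group_add \<Rightarrow> 'd) \<Rightarrow> (int \<Rightarrow> 'd set) \<Rightarrow>
    (nat \<Rightarrow> 'd \<Rightarrow> ('f, 'd) tensor) \<Rightarrow> (nat \<Rightarrow> 'c \<Rightarrow> ('f, 'd) tensor) \<Rightarrow> bool" where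
  "ainf_isomorphism scale C \<Delta> scale' C' \<Delta>' f \<longleftrightarrow>
     ainf_morphism scale C \<Delta> scale' C' \<Delta>' f \<and> bij_betw (f 1) UNIV (tpow scale' 1)"

definition ainf_isomorphic :: "('f::field \<Rightarrow> 'c::ab_group_add \<Rightarrow> 'c) \<Rightarrow> (int \<Rightarrow> 'c set) \<Rightarrow>
    (nat \<Rightarrow> 'c \<Rightarrow> ('f, 'c) tensor) \<Rightarrow> ('f \<Rightarrow> 'd::ab_group_add \<Rightarrow> 'd) \<Rightarrow> (int \<Rightarrow> 'd set) \<Rightarrow>
    (nat \<Rightarrow> 'd \<Rightarrow> ('f, 'd) tensor) \<Rightarrow> bool" where
  "ainf_isomorphic scale C \<Delta> scale' C' \<Delta>' \<longleftrightarrow> (\<exists>f. ainf_isomorphism scale C \<Delta> scale' C' \<Delta>' f)"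

definition first_nonzero :: "(nat \<Rightarrow> 'c \<Rightarrow> ('f::field, 'c) tensor) \<Rightarrow> enat" where
  "first_nonzero \<Delta> = (if \<exists>n\<ge>1. \<Delta> n \<noteq> (\<lambda>x. 0) then enat (LEAST n. n \<ge> 1 \<and> \<Delta> n \<noteq> (\<lambda>x. 0)) else \<infinity>)"

end

theory Submission
  imports Defs
begin

text \<open>
  Let \<open>\<phi>\<close> be the linear part of the isomorphism; it is a degree-preserving linear bijection of \<open>C\<close>.
  If \<open>\<Delta>\<close> and \<open>\<Delta>'\<close> vanish below arity \<open>N\<close>, then in arity \<open>N\<close> the morphism equation, evaluated on a
  generator, contains only the linear part of the isomorphism and says that \<open>\<phi>\<close> intertwines
  \<open>\<Delta> N\<close> and \<open>\<Delta>' N\<close> up to the desuspension signs.  Tensor powers of \<open>\<phi>\<close> and desuspension are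
  injective, so \<open>\<Delta> N x = 0\<close> if and only if \<open>\<Delta>' N (\<phi> x) = 0\<close>.  By induction on \<open>N\<close> the two leading
  arities agree, and up to that arity \<open>\<phi>\<close> maps the kernels of \<open>\<Delta>\<close> onto those of \<open>\<Delta>'\<close>.
\<close>

section \<open>Graded vector spaces and dimension\<close>

text \<open>\<open>derivation_ext\<close> and \<open>algebra_ext\<close> take their Koszul signs
  from the shifted grading, so evaluating them through \<open>kmap_tens\<close> requires
  \<open>desusp C\<close> to be a grading too.\<close>

lemma graded_vector_space_desusp:
  assumes "graded_vector_space scale C"
  shows "graded_vector_space scale (desusp C)"
proof -
  interpret graded_vector_space scale C by fact
  show ?thesis
  proof (unfold_locales, goal_cases)
    case (1 p)
    show ?case by (simp add: desusp_def subspace_deg)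
  next
    case (2 x)
    have img: "{p. hcomp C x (p + 1) \<noteq> 0} = (\<lambda>q. q - 1) ` {q. hcomp C x q \<noteq> 0}"
      by (force simp: image_iff intro: exI[of _ "_ + 1"])
    show ?case
    proof (rule ex1I[of _ "\<lambda>p. hcomp C x (p + 1)"], intro conjI allI)
      show "hcomp C x (p + 1) \<in> desusp C p" for p
        by (simp add: desusp_def hcomp_in)
      show "finite {p. hcomp C x (p + 1) \<noteq> 0}"
        unfolding img using finite_hcomp by blast
      have "(\<Sum>p | hcomp C x (p + 1) \<noteq> 0. hcomp C x (p + 1)) = (\<Sum>p | hcomp C x p \<noteq> 0. hcomp C x p)"
        unfolding img by (subst sum.reindex) (auto simp: inj_on_def)
      then show "x = (\<Sum>p | hcomp C x (p + 1) \<noteq> 0. hcomp C x (p + 1))"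
        by (simp add: sum_hcomp)
    next
      fix c assume c: "(\<forall>p. c p \<in> desusp C p) \<and> finite {p. c p \<noteq> 0} \<and> x = (\<Sum>p | c p \<noteq> 0. c p)"
      \<comment> \<open>Shifting back a decomposition for \<open>desusp C\<close> gives one for
        \<open>C\<close>, where uniqueness is known.\<close>
      have "hcomp C x = (\<lambda>p. c (p - 1))"
      proof (rule hcomp_unique[where A = "(\<lambda>p. p + 1) ` {p. c p \<noteq> 0}"])
        show "c (p - 1) \<in> C p" for p using c by (auto simp: desusp_def dest: spec[of _ "p - 1"])
        show "c (p - 1) = 0" if "p \<notin> (\<lambda>p. p + 1) ` {p. c p \<noteq> 0}" for p
          using that by (force simp: image_iff)
        show "x = (\<Sum>p\<in>(\<lambda>p. p + 1) ` {p. c p \<noteq> 0}. c (p - 1))"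
          using c by (subst sum.reindex) (auto simp: inj_on_def)
      qed (use c in auto)
      then show "c = (\<lambda>p. hcomp C x (p + 1))" by simp
    qed
  qed
qed

section \<open>Homogeneous components and Koszul signs\<close>

context graded_vector_space
begin

lemma linear_eq_0_on_homogeneous:
  assumes "Vector_Spaces.linear scale scale' g" and "\<And>p x. x \<in> C p \<Longrightarrow> g x = 0"
  shows "g x = 0"
proof -
  interpret g: Vector_Spaces.linear scale scale' g by fact
  show ?thesis
    by (subst sum_hcomp[of x, symmetric]) (simp add: g.sum assms(2)[OF hcomp_in])
qed

lemma hcomp_twist: "hcomp C (twist C d x) = (\<lambda>p. if even (d * p) then hcomp C x p else - hcomp C x p)"
  by (rule hcomp_unique[where A = "{p. hcomp C x p \<noteq> 0}"])
    (auto simp: twist_def hcomp_in finite_hcomp subspace_neg[OF subspace_deg])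

text \<open>The sign on each homogeneous component squares to one. This is the source of the
  invertibility of desuspension on tensor powers.\<close>

lemma twist_twist [simp]: "twist C d (twist C d x) = x"
proof -
  have "{p. hcomp C (twist C d x) p \<noteq> 0} \<subseteq> {p. hcomp C x p \<noteq> 0}"
    by (auto simp: hcomp_twist)
  from twist_superset[OF finite_hcomp this, of d] show ?thesis
    by (simp add: hcomp_twist sum_hcomp if_distrib cong: if_cong)
qed

lemma twist_0 [simp]: "twist C 0 x = x"
  by (simp add: twist_def sum_hcomp)

end

text \<open>By uniqueness, \<open>\<phi>\<close> carries the components of \<open>x\<close> to those
  of \<open>\<phi> x\<close>. If \<open>\<phi> x\<close> is homogeneous of degree \<open>p\<close>,
  injectivity forces \<open>x\<close> to equal its own component of degree \<open>p\<close>. A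
  bijective \<open>\<phi>\<close> therefore restricts to a bijection in every single degree.\<close>

lemma graded_bij_deg_iff:
  assumes "graded_vector_space scale C" "graded_vector_space scale' C'"
    and \<phi>: "Vector_Spaces.linear scale scale' \<phi>" "inj \<phi>" and deg: "\<And>p x. x \<in> C p \<Longrightarrow> \<phi> x \<in> C' p"
  shows "\<phi> x \<in> C' p \<longleftrightarrow> x \<in> C p"
proof
  interpret G: graded_vector_space scale C by fact
  interpret G': graded_vector_space scale' C' by fact
  interpret \<phi>: Vector_Spaces.linear scale scale' \<phi> by fact
  assume x: "\<phi> x \<in> C' p"
  have "hcomp C' (\<phi> x) = (\<lambda>q. \<phi> (hcomp C x q))"
  proof (rule G'.hcomp_unique[where A = "{q. hcomp C x q \<noteq> 0}"])
    show "\<phi> x = (\<Sum>q | hcomp C x q \<noteq> 0. \<phi> (hcomp C x q))"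
      by (simp add: G.sum_hcomp flip: \<phi>.sum)
  qed (auto simp: deg G.hcomp_in G.finite_hcomp)
  then have "\<phi> (hcomp C x q) = (if q = p then \<phi> x else 0)" for q
    using G'.hcomp_homogeneous[OF x] by metis
  from this[of p] have "hcomp C x p = x"
    using injD[OF \<phi>(2)] by simp
  then show "x \<in> C p" using G.hcomp_in[of x p] by simp
qed (rule deg)

text \<open>\<open>cdim\<close> selects a basis by choice, so the image of the basis selected for
  \<open>S\<close> need not be the one selected for \<open>S'\<close>. Both are bases of
  \<open>S'\<close>, hence in bijection.\<close>

lemma cdim_ordIso:
  assumes "vector_space scale" "vector_space scale'"
    and \<phi>: "Vector_Spaces.linear scale scale' \<phi>" "inj \<phi>"
    and S: "module.subspace scale S" and S': "S' = \<phi> ` S"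
  shows "(cdim scale S, cdim scale' S') \<in> ordIso"
proof -
  interpret V: vector_space scale by fact
  interpret W: vector_space scale' by fact
  interpret P: vector_space_pair scale scale' ..
  interpret \<phi>: Vector_Spaces.linear scale scale' \<phi> by fact
  define B where "B = (SOME B. \<not> V.dependent B \<and> V.span B = S)"
  define B' where "B' = (SOME B. \<not> W.dependent B \<and> W.span B = S')"
  have B: "\<not> V.dependent B \<and> V.span B = S"
    unfolding B_def by (rule someI_ex) (metis S V.basis_exists V.span_subspace)
  have \<phi>B: "W.span (\<phi> ` B) = S'" "\<not> W.dependent (\<phi> ` B)"
    using B S' \<phi> P.linear_independent_injective_image[of \<phi> B] inj_on_subset[of \<phi> UNIV]
    by (auto simp: P.linear_span_image)
  have B': "\<not> W.dependent B' \<and> W.span B' = S'"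
    unfolding B'_def by (rule someI_ex) (use \<phi>B in blast)
  obtain h where "bij_betw h (\<phi> ` B) B'"
    using W.bij_if_span_eq_span_bases[of "\<phi> ` B" B'] \<phi>B B' by auto
  moreover have "bij_betw \<phi> B (\<phi> ` B)"
    using \<phi>(2) by (simp add: bij_betw_def inj_on_def)
  ultimately have "bij_betw (h \<circ> \<phi>) B B'"
    by (rule bij_betw_trans[rotated])
  then show ?thesis
    unfolding cdim_def B_def[symmetric] B'_def[symmetric] using card_of_ordIso by blast
qed


section \<open>Tensor powers of maps\<close>

text \<open>The type of tensors contains arbitrary functionals. Linearity on forms and vanishing off
  forms hold only on this span, the whole tensor algebra, so membership in it is tracked
  throughout.\<close>

abbreviation tensors :: "('f::field \<Rightarrow> 'c::ab_group_add \<Rightarrow> 'c) \<Rightarrow> ('f, 'c) tensor set" where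
  "tensors scale \<equiv> module.span tscale (range (tens scale))"

lemma tpow_subset:
  fixes scale :: "'f::field \<Rightarrow> 'c::ab_group_add \<Rightarrow> 'c"
  shows "tpow scale n \<subseteq> tensors scale"
proof -
  interpret T: vector_space "tscale :: 'f \<Rightarrow> ('f, 'c) tensor \<Rightarrow> _" by (rule vector_space_tscale)
  show ?thesis unfolding tpow_def by (rule T.span_mono) auto
qed

lemma tpow_deg_subset:
  fixes scale :: "'f::field \<Rightarrow> 'c::ab_group_add \<Rightarrow> 'c"
  shows "tpow_deg scale C n q \<subseteq> tpow scale n"
proof -
  interpret T: vector_space "tscale :: 'f \<Rightarrow> ('f, 'c) tensor \<Rightarrow> _" by (rule vector_space_tscale)
  show ?thesis unfolding tpow_def tpow_deg_def by (rule T.span_mono) auto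
qed

lemma tens_in_tpow:
  fixes scale :: "'f::field \<Rightarrow> 'c::ab_group_add \<Rightarrow> 'c"
  shows "tens scale xs \<in> tpow scale (length xs)"
proof -
  interpret T: vector_space "tscale :: 'f \<Rightarrow> ('f, 'c) tensor \<Rightarrow> _" by (rule vector_space_tscale)
  show ?thesis unfolding tpow_def by (rule T.span_base) auto
qed

lemma tens_in_tensors: "tens scale xs \<in> tensors scale"
  using tens_in_tpow tpow_subset by fast

lemma zero_in_tpow_deg:
  fixes scale :: "'f::field \<Rightarrow> 'c::ab_group_add \<Rightarrow> 'c"
  shows "0 \<in> tpow_deg scale C n q"
proof -
  interpret T: vector_space "tscale :: 'f \<Rightarrow> ('f, 'c) tensor \<Rightarrow> _" by (rule vector_space_tscale)
  show ?thesis unfolding tpow_deg_def by (rule T.span_zero)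
qed

lemma tens_in_tpow_deg_1:
  fixes scale :: "'f::field \<Rightarrow> 'c::ab_group_add \<Rightarrow> 'c"
  assumes "x \<in> C q"
  shows "tens scale [x] \<in> tpow_deg scale C 1 q"
proof -
  interpret T: vector_space "tscale :: 'f \<Rightarrow> ('f, 'c) tensor \<Rightarrow> _" by (rule vector_space_tscale)
  show ?thesis unfolding tpow_deg_def
    by (rule T.span_base) (use assms in \<open>auto intro!: exI[of _ "[x]"] exI[of _ "[q]"]\<close>)
qed

lemma linear_tens:
  assumes "vector_space scale"
  shows "Vector_Spaces.linear scale tscale (\<lambda>x. tens scale [x])"
  unfolding linear_iff_vs[OF assms vector_space_tscale]
proof (intro conjI allI ext)
  fix x y a \<phi>
  show "tens scale [x + y] \<phi> = (tens scale [x] + tens scale [y]) \<phi>"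
    "tens scale [scale a x] \<phi> = tscale a (tens scale [x]) \<phi>"
    using form_iff[OF assms, of \<phi>] by (auto simp: tens_def tscale_def dest: spec[of _ "[]"])
qed

lemma tmult_0_left [simp]: "tmult scale 0 u = 0"
  by (auto simp: tmult_def)

text \<open>Homogeneity with factor 0, applied to the zero form.\<close>

lemma linear_on_forms_zero:
  assumes "vector_space scale" "t \<in> tensors scale"
  shows "t (\<lambda>_. 0) = 0"
  using linear_on_forms(3)[OF assms, of "\<lambda>_. 0" 0] form_iff[OF assms(1), of "\<lambda>_. 0"] by simp

lemma tmult_0_right:
  assumes "vector_space scale" "t \<in> tensors scale"
  shows "tmult scale t 0 = 0"
  by (auto simp: tmult_def linear_on_forms_zero[OF assms])

section \<open>Koszul tensor products of maps: linearity, zero factors, single factors\<close>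

lemma linear_kmap: "Vector_Spaces.linear tscale tscale (kmap C scale gs)"
  unfolding linear_iff_vs[OF vector_space_tscale vector_space_tscale]
  by (auto simp: kmap_def tscale_def)

lemma kmap_0 [simp]: "kmap C scale gs 0 = 0"
  by (auto simp: kmap_def)

lemma kmap_in_tensors:
  fixes scale :: "'f::field \<Rightarrow> 'c::ab_group_add \<Rightarrow> 'c" and scale' :: "'f \<Rightarrow> 'd::ab_group_add \<Rightarrow> 'd"
  assumes V: "vector_space scale" "vector_space scale'" "graded_vector_space scale C"
    and gs: "\<forall>(d, g) \<in> set gs. Vector_Spaces.linear scale tscale g \<and> range g \<subseteq> tensors scale'"
    and t: "t \<in> tensors scale"
  shows "kmap C scale' gs t \<in> tensors scale'"
proof -
  interpret T: vector_space "tscale :: 'f \<Rightarrow> ('f, 'c) tensor \<Rightarrow> _" by (rule vector_space_tscale)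
  interpret T': vector_space "tscale :: 'f \<Rightarrow> ('f, 'd) tensor \<Rightarrow> _" by (rule vector_space_tscale)
  interpret K: Vector_Spaces.linear tscale tscale "kmap C scale' gs" by (rule linear_kmap)
  have tens: "kmap C scale' gs (tens scale xs) \<in> tensors scale'" for xs
    unfolding kmap_tens[OF V gs] using gs by (intro ktensor_span[OF V(2)]) fastforce
  from t show ?thesis
  proof (induction rule: T.span_induct_alt)
    case (step c x y)
    then have "kmap C scale' gs x \<in> tensors scale'" using tens by blast
    then show ?case unfolding K.add K.scale by (intro T'.span_add T'.span_scale step.IH)
  qed (simp only: kmap_0 T'.span_zero)
qed

text \<open>A zero factor at the head kills the product from the left, a later one kills it from the
  right. This removes the terms of the morphism equation in which a structure map vanishes.\<close>

lemma kmap_zero_entry: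
  assumes V: "vector_space scale" "vector_space scale'"
    and gs: "\<forall>(d, g) \<in> set gs. range g \<subseteq> tensors scale'"
    and zero: "(d, \<lambda>_. 0) \<in> set gs" and t: "t \<in> tensors scale"
  shows "kmap C scale' gs t = 0"
proof -
  have "ktensor C scale' gs xs = 0" for xs
    using gs zero V(2)
  proof (induction C scale' gs xs rule: ktensor.induct)
    case (2 C scale' e g gs x xs)
    show ?case
    proof (cases "(d, \<lambda>_. 0) = (e, g)")
      case True
      then show ?thesis by (auto simp only: prod.inject ktensor.simps tmult_0_left)
    next
      case False
      then have "(d, \<lambda>_. 0) \<in> set gs" using "2.prems"(2) by (metis set_ConsD)
      then have "ktensor C scale' gs xs = 0" using "2.IH" "2.prems" by (metis list.set_intros(2))
      moreover have "g y \<in> tensors scale'" for y using "2.prems"(1) by auto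
      ultimately show ?thesis by (simp only: ktensor.simps tmult_0_right[OF "2.prems"(3)])
    qed
  qed auto
  then show ?thesis
    by (auto simp: kmap_def linear_on_forms_zero[OF V(1) t])
qed

text \<open>No sign appears: the exponent in the twist is the sum over the empty list of remaining
  factors. The trailing \<open>tens scale' []\<close> is the unit of the tensor algebra.\<close>

lemma kmap_single_tens:
  assumes V: "vector_space scale" "vector_space scale'" "graded_vector_space scale C"
    and g: "Vector_Spaces.linear scale tscale g" "range g \<subseteq> tensors scale'"
  shows "kmap C scale' [(d, g)] (tens scale [x]) = g x"
proof -
  interpret graded_vector_space scale C by fact
  have "tmult scale' (g x) (tens scale' []) \<phi> = g x \<phi>" for \<phi>
  proof (cases "form scale' \<phi>")
    case True
    then have "form scale' (\<lambda>v. \<phi> (xs @ v))" for xs by (rule form_shift[OF V(2)])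
    with True show ?thesis by (simp add: tmult_def tens_def)
  next
    \<comment> \<open>Off forms \<open>tmult\<close> is 0 by definition, and \<open>g x\<close> is 0
      because it lies in the span of tensors.\<close>
    case False
    moreover have "g x \<in> tensors scale'" using g(2) by auto
    ultimately show ?thesis using linear_on_forms(1)[OF V(2)] by (simp add: tmult_def)
  qed
  then have "tmult scale' (g x) (tens scale' []) = g x" by blast
  then show ?thesis using g by (subst kmap_tens[OF V]) auto
qed

text \<open>\<open>K\<close> only replaces the entries of a tensor by twisted ones, and twisting is
  an involution. Taking \<open>d = -1\<close> shows that desuspension is its own inverse on each
  tensor power.\<close>

lemma kmap_id_involution:
  fixes scale :: "'f::field \<Rightarrow> 'c::ab_group_add \<Rightarrow> 'c" and d :: int
  assumes "graded_vector_space scale C" and t: "t \<in> tpow scale n"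
  defines "K \<equiv> kmap C scale (replicate n (d, \<lambda>x. tens scale [x]))"
  shows "K (K t) = t"
proof -
  interpret G: graded_vector_space scale C by fact
  interpret T: vector_space "tscale :: 'f \<Rightarrow> ('f, 'c) tensor \<Rightarrow> _" by (rule vector_space_tscale)
  interpret TT: vector_space_pair "tscale :: 'f \<Rightarrow> ('f, 'c) tensor \<Rightarrow> _" "tscale :: 'f \<Rightarrow> ('f, 'c) tensor \<Rightarrow> _" ..
  have V: "vector_space scale" ..
  let ?gs = "\<lambda>n. replicate n (d, \<lambda>x. tens scale [x])"
  \<comment> \<open>The witness \<open>ys\<close> is \<open>xs\<close> with each entry twisted by
    \<open>d\<close> times the number of entries to its right. Both equations are carried through
    one induction so that the same \<open>ys\<close> serves for both.\<close>
  have *: "\<exists>ys. ktensor C scale (?gs n) xs = tens scale ys \<and> ktensor C scale (?gs n) ys = tens scale xs"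
    if "length xs = n" for xs n
    using that
  proof (induction n arbitrary: xs)
    case 0
    then show ?case by (auto intro: exI[of _ "[]"])
  next
    case (Suc n)
    then obtain x xs' where xs: "xs = x # xs'" "length xs' = n" by (cases xs) auto
    with Suc.IH obtain ys where "ktensor C scale (?gs n) xs' = tens scale ys"
      "ktensor C scale (?gs n) ys = tens scale xs'" by blast
    then show ?case
      by (intro exI[of _ "twist C (sum_list (map fst (?gs n))) x # ys"])
        (simp add: xs tmult_tens[OF V])
  qed
  have gs: "\<forall>(d, g) \<in> set (?gs n). Vector_Spaces.linear scale tscale g \<and> range g \<subseteq> tensors scale"
    using linear_tens[OF V] tens_in_tensors by fastforce
  have "K (K (tens scale xs)) = tens scale xs" if "length xs = n" for xs
    using *[OF that] unfolding K_def by (auto simp: kmap_tens[OF V V assms(1) gs])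
  moreover have "Vector_Spaces.linear tscale tscale (\<lambda>t. K (K t))"
    using Vector_Spaces.linear_compose[OF linear_kmap linear_kmap] unfolding K_def o_def .
  ultimately show ?thesis
    using TT.linear_eq_on[OF _ T.linear_id, of "\<lambda>t. K (K t)" t "{tens scale xs | xs. length xs = n}"] t
    unfolding tpow_def by auto
qed

lemma desusp_map_eq_0_iff:
  assumes "graded_vector_space scale C" "t \<in> tpow scale n"
  shows "desusp_map C scale n t = 0 \<longleftrightarrow> t = 0"
  using kmap_id_involution[OF assms, of "-1"] by (metis desusp_map_def kmap_0)

lemma desusp_map_in_tensors:
  assumes "graded_vector_space scale C" "t \<in> tensors scale"
  shows "desusp_map C scale n t \<in> tensors scale"
proof -
  interpret graded_vector_space scale C by fact
  have V: "vector_space scale" ..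
  show ?thesis
    unfolding desusp_map_def using linear_tens[OF V] tens_in_tensors
    by (intro kmap_in_tensors[OF V V assms(1) _ assms(2)]) fastforce
qed

text \<open>Twisting entries keeps the length of a tensor. Hence the injectivity result for tensor
  powers of a bijection also applies after desuspension.\<close>

lemma desusp_map_in_tpow:
  fixes scale :: "'f::field \<Rightarrow> 'c::ab_group_add \<Rightarrow> 'c"
  assumes "graded_vector_space scale C" and t: "t \<in> tpow scale n"
  shows "desusp_map C scale n t \<in> tpow scale n"
proof -
  interpret graded_vector_space scale C by fact
  interpret T: vector_space "tscale :: 'f \<Rightarrow> ('f, 'c) tensor \<Rightarrow> _" by (rule vector_space_tscale)
  interpret K: Vector_Spaces.linear tscale tscale "desusp_map C scale n"
    unfolding desusp_map_def by (rule linear_kmap)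
  have V: "vector_space scale" ..
  let ?gs = "\<lambda>n. replicate n (-1, \<lambda>x. tens scale [x])"
  have *: "ktensor C scale (?gs n) xs \<in> tens scale ` {ys. length ys = n}" if "length xs = n" for xs n
    using that
  proof (induction n arbitrary: xs)
    case (Suc n)
    then obtain x xs' where xs: "xs = x # xs'" "length xs' = n" by (cases xs) auto
    with Suc.IH obtain ys where "ktensor C scale (?gs n) xs' = tens scale ys" "length ys = n" by blast
    then show ?case
      by (intro image_eqI[of _ _ "twist C (sum_list (map fst (?gs n))) x # ys"])
        (simp_all add: xs tmult_tens[OF V])
  qed simp
  have gs: "\<forall>(d, g) \<in> set (?gs n). Vector_Spaces.linear scale tscale g \<and> range g \<subseteq> tensors scale"
    using linear_tens[OF V] tens_in_tensors by fastforce
  have tens: "desusp_map C scale n (tens scale xs) \<in> tpow scale n" if "length xs = n" for xs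
    using *[OF that] tens_in_tpow
    unfolding desusp_map_def kmap_tens[OF V V assms(1) gs] by fastforce
  from t show ?thesis
    unfolding tpow_def
  proof (induction rule: T.span_induct_alt)
    case base
    show ?case by (simp only: K.zero T.span_zero)
  next
    case (step c x y)
    then have "desusp_map C scale n x \<in> T.span {tens scale xs | xs. length xs = n}"
      using tens[unfolded tpow_def] by blast
    then show ?case unfolding K.add K.scale by (intro T.span_add T.span_scale step.IH)
  qed
qed

text \<open>The tensor power of a linear left inverse of \<open>\<phi>\<close> is a left inverse of
  the tensor power of \<open>\<phi>\<close>. All factors are labelled with degree 0, so no signs
  enter.\<close>

lemma kmap_bij_eq_0_iff:
  fixes scale :: "'f::field \<Rightarrow> 'c::ab_group_add \<Rightarrow> 'c" and scale' :: "'f \<Rightarrow> 'd::ab_group_add \<Rightarrow> 'd"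
  assumes G: "graded_vector_space scale C" "graded_vector_space scale' C'"
    and \<phi>: "Vector_Spaces.linear scale scale' \<phi>" "bij \<phi>" and t: "t \<in> tpow scale n"
  shows "kmap C scale' (replicate n (0, \<lambda>x. tens scale' [\<phi> x])) t = 0 \<longleftrightarrow> t = 0"
proof
  interpret G: graded_vector_space scale C by fact
  interpret G': graded_vector_space scale' C' by fact
  interpret T: vector_space "tscale :: 'f \<Rightarrow> ('f, 'c) tensor \<Rightarrow> _" by (rule vector_space_tscale)
  interpret TT: vector_space_pair "tscale :: 'f \<Rightarrow> ('f, 'c) tensor \<Rightarrow> _" "tscale :: 'f \<Rightarrow> ('f, 'c) tensor \<Rightarrow> _" ..
  interpret P: vector_space_pair scale scale' ..
  have V: "vector_space scale" "vector_space scale'" ..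
  \<comment> \<open>Stated for arbitrary spaces because it serves both \<open>\<phi>\<close> and its
    left inverse, which runs in the opposite direction.\<close>
  have ktens: "kmap D s (replicate n (0, \<lambda>x. tens s [\<chi> x])) (tens r xs) = tens s (map \<chi> xs)"
    if "graded_vector_space r D" "vector_space r" "vector_space s" "Vector_Spaces.linear r s \<chi>" "length xs = n"
    for D :: "int \<Rightarrow> 'x::ab_group_add set" and \<chi> :: "'x \<Rightarrow> 'y::ab_group_add" and r s xs
  proof -
    interpret D: graded_vector_space r D by fact
    have "Vector_Spaces.linear r tscale (\<lambda>x. tens s [\<chi> x])"
      using Vector_Spaces.linear_compose[OF that(4) linear_tens[OF that(3)]] unfolding o_def .
    then have "\<forall>(d, g) \<in> set (replicate n (0, \<lambda>x. tens s [\<chi> x])).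
        Vector_Spaces.linear r tscale g \<and> range g \<subseteq> tensors s"
      using tens_in_tensors by fastforce
    then have "kmap D s (replicate n (0, \<lambda>x. tens s [\<chi> x])) (tens r xs) =
        ktensor D s (replicate n (0, \<lambda>x. tens s [\<chi> x])) xs"
      by (rule kmap_tens[OF that(2,3,1)])
    also have "\<dots> = tens s (map \<chi> xs)"
      using that(5) by (induction n arbitrary: xs) (auto simp: length_Suc_conv tmult_tens[OF that(3)] sum_list_replicate)
    finally show ?thesis .
  qed
  let ?K = "kmap C scale' (replicate n (0, \<lambda>x. tens scale' [\<phi> x]))"
  obtain \<psi> where \<psi>: "\<psi> \<circ> \<phi> = id" "Vector_Spaces.linear scale' scale \<psi>"
    using P.linear_injective_left_inverse[OF \<phi>(1) bij_is_inj[OF \<phi>(2)]] by blast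
  let ?K' = "kmap C' scale (replicate n (0, \<lambda>x. tens scale [\<psi> x]))"
  have "?K' (?K (tens scale xs)) = tens scale xs" if "length xs = n" for xs
    using that \<psi>(1) by (simp add: ktens[OF G(1) V \<phi>(1)] ktens[OF G(2) V(2,1) \<psi>(2)])
  moreover have "Vector_Spaces.linear tscale tscale (\<lambda>t. ?K' (?K t))"
    using Vector_Spaces.linear_compose[OF linear_kmap linear_kmap] unfolding o_def .
  ultimately have "?K' (?K t) = t"
    using TT.linear_eq_on[OF _ T.linear_id, of "\<lambda>t. ?K' (?K t)" t "{tens scale xs | xs. length xs = n}"] t
    unfolding tpow_def by auto
  then show "?K t = 0 \<Longrightarrow> t = 0" by simp
qed simp

section \<open>Maps of fixed degree and their desuspensions\<close>

lemma degree_map_in_tpow: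
  fixes scale :: "'f::field \<Rightarrow> 'c::ab_group_add \<Rightarrow> 'c" and scale' :: "'f \<Rightarrow> 'd::ab_group_add \<Rightarrow> 'd"
  assumes G: "graded_vector_space scale C" and g: "degree_map scale C scale' C' n d g"
  shows "g x \<in> tpow scale' n"
proof -
  interpret graded_vector_space scale C by fact
  interpret T: vector_space "tscale :: 'f \<Rightarrow> ('f, 'd) tensor \<Rightarrow> _" by (rule vector_space_tscale)
  interpret g: Vector_Spaces.linear scale tscale g using g by (simp add: degree_map_def)
  have "g (hcomp C x p) \<in> tpow scale' n" for p
    using g hcomp_in tpow_deg_subset unfolding degree_map_def by blast
  then have "(\<Sum>p | hcomp C x p \<noteq> 0. g (hcomp C x p)) \<in> tpow scale' n"
    unfolding tpow_def by (intro T.span_sum)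
  then show ?thesis by (simp add: sum_hcomp flip: g.sum)
qed

lemma linear_desusp_map_comp:
  assumes "degree_map scale C scale' C' n d g"
  shows "Vector_Spaces.linear scale tscale (\<lambda>x. desusp_map D scale' m (g x))"
  using Vector_Spaces.linear_compose[OF _ linear_kmap] assms
  unfolding degree_map_def desusp_map_def o_def by blast

lemma desusp_in_tensors:
  fixes scale :: "'f::field \<Rightarrow> 'c::ab_group_add \<Rightarrow> 'c" and scale' :: "'f \<Rightarrow> 'd::ab_group_add \<Rightarrow> 'd"
  assumes G: "graded_vector_space scale C" "graded_vector_space scale' C'"
    and g: "degree_map scale C scale' C' n d g"
  shows "range (\<lambda>x. desusp_map C' scale' m (g x)) \<subseteq> tensors scale'"
    and "range (\<lambda>x. - desusp_map C' scale' m (g x)) \<subseteq> tensors scale'"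
proof -
  interpret T: vector_space "tscale :: 'f \<Rightarrow> ('f, 'd) tensor \<Rightarrow> _" by (rule vector_space_tscale)
  have "desusp_map C' scale' m (g x) \<in> tensors scale'" for x
    using degree_map_in_tpow[OF G(1) g] tpow_subset by (intro desusp_map_in_tensors[OF G(2)]) blast
  then show "range (\<lambda>x. desusp_map C' scale' m (g x)) \<subseteq> tensors scale'"
    and "range (\<lambda>x. - desusp_map C' scale' m (g x)) \<subseteq> tensors scale'"
    using T.span_neg by auto
qed

text \<open>The universal property is applied to the multilinear function that reads off the entry
  of a one-element list and is 0 on all other lengths. The resulting \<open>h\<close> turns elements
  of the first tensor power back into vectors.\<close>

lemma ex_tens_left_inverse:
  assumes "vector_space scale"
  shows "\<exists>h. Vector_Spaces.linear tscale scale h \<and> (\<forall>x. h (tens scale [x]) = x)"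
proof -
  interpret vector_space scale by fact
  let ?g = "\<lambda>xs. case xs of [x] \<Rightarrow> x | _ \<Rightarrow> 0"
  have "Vector_Spaces.linear scale scale (\<lambda>x. ?g (xs @ x # ys))" for xs ys
    unfolding linear_iff_vs[OF assms assms] by (cases xs; cases ys) (auto split: list.splits)
  then have "multilinear scale scale ?g" by (simp add: multilinear_def)
  from tensor_universal_property[OF assms assms this] obtain h
    where "Vector_Spaces.linear tscale scale h" "\<forall>xs. h (tens scale xs) = ?g xs" by blast
  then show ?thesis by auto
qed


section \<open>The leading arity\<close>

text \<open>The two sides of the morphism equation are evaluated on the generator \<open>x\<close>
  and compared in tensor power \<open>N\<close>. Vanishing below \<open>N\<close> leaves one summand
  on each side, and both involve only the linear part of \<open>f\<close>.\<close>

lemma morphism_leading_term: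
  fixes scale :: "'f::field \<Rightarrow> 'c::ab_group_add \<Rightarrow> 'c" and scale' :: "'f \<Rightarrow> 'd::ab_group_add \<Rightarrow> 'd"
  assumes G: "graded_vector_space scale C" "graded_vector_space scale' C'"
    and \<Delta>: "\<And>n. n \<ge> 1 \<Longrightarrow> degree_map scale C scale C n (int n - 2) (\<Delta> n)"
    and \<Delta>': "\<And>n. n \<ge> 1 \<Longrightarrow> degree_map scale' C' scale' C' n (int n - 2) (\<Delta>' n)"
    and mor: "ainf_morphism scale C \<Delta> scale' C' \<Delta>' f"
    and \<phi>: "\<And>x. f 1 x = tens scale' [\<phi> x]"
    and N: "N \<ge> 1" and below: "\<And>n. 1 \<le> n \<Longrightarrow> n < N \<Longrightarrow> \<Delta> n = (\<lambda>x. 0) \<and> \<Delta>' n = (\<lambda>x. 0)"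
    and x: "x \<in> C q"
  shows "kmap (desusp C) scale' (replicate N (0, \<lambda>x. tens scale' [\<phi> x])) (desusp_map C scale N (\<Delta> N x)) =
    desusp_map C' scale' N (\<Delta>' N (\<phi> x))"
proof -
  interpret G: graded_vector_space scale C by fact
  interpret G': graded_vector_space scale' C' by fact
  have V: "vector_space scale" "vector_space scale'" ..
  interpret T: vector_space "tscale :: 'f \<Rightarrow> ('f, 'c) tensor \<Rightarrow> _" by (rule vector_space_tscale)
  interpret T': vector_space "tscale :: 'f \<Rightarrow> ('f, 'd) tensor \<Rightarrow> _" by (rule vector_space_tscale)
  interpret P: vector_space_pair scale "tscale :: 'f \<Rightarrow> ('f, 'c) tensor \<Rightarrow> _" ..
  interpret P': vector_space_pair scale' "tscale :: 'f \<Rightarrow> ('f, 'd) tensor \<Rightarrow> _" ..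
  note D = graded_vector_space_desusp[OF G(1)] graded_vector_space_desusp[OF G(2)]
  \<comment> \<open>The generator \<open>x\<close>, placed in arity 1 of the complete tensor
    algebra. Its degree there is \<open>q - 1\<close> because of the desuspension.\<close>
  define t :: "nat \<Rightarrow> ('f, 'c) tensor" where "t = (\<lambda>n. if n = 1 then tens scale [x] else 0)"
  define F where "F = (\<lambda>k x. desusp_map C' scale' k (f k x))"
  define \<delta> where "\<delta> = (\<lambda>n x. - desusp_map C scale n (\<Delta> n x))"
  define \<delta>' where "\<delta>' = (\<lambda>n x. - desusp_map C' scale' n (\<Delta>' n x))"
  have t: "t \<in> complete_tensor_deg scale (desusp C) (q - 1)"
    using x tens_in_tpow_deg_1[of x "desusp C" "q - 1"]
    by (auto simp: complete_tensor_deg_def t_def zero_in_tpow_deg desusp_def)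
  have f: "degree_map scale C scale' C' k (int k - 1) (f k)" if "k \<ge> 1" for k
    using mor that by (simp add: ainf_morphism_def)
  have F_good: "Vector_Spaces.linear scale tscale (F k)" "range (F k) \<subseteq> tensors scale'" if "k \<ge> 1" for k
    unfolding F_def
    using linear_desusp_map_comp[OF f[OF that]] desusp_in_tensors(1)[OF G f[OF that]] by simp_all
  have \<delta>_good: "Vector_Spaces.linear scale tscale (\<delta> n)" "range (\<delta> n) \<subseteq> tensors scale" if "n \<ge> 1" for n
    unfolding \<delta>_def
    using P.linear_compose_neg[OF linear_desusp_map_comp[OF \<Delta>[OF that]]]
      desusp_in_tensors(2)[OF G(1) G(1) \<Delta>[OF that]] by simp_all
  have \<delta>'_good: "Vector_Spaces.linear scale' tscale (\<delta>' n)" "range (\<delta>' n) \<subseteq> tensors scale'" if "n \<ge> 1" for n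
    unfolding \<delta>'_def
    using P'.linear_compose_neg[OF linear_desusp_map_comp[OF \<Delta>'[OF that]]]
      desusp_in_tensors(2)[OF G(2) G(2) \<Delta>'[OF that]] by simp_all
  have \<delta>_0: "\<delta> n = (\<lambda>x. 0)" "\<delta>' n = (\<lambda>x. 0)" if "1 \<le> n" "n < N" for n
    using below[OF that] by (simp_all add: \<delta>_def \<delta>'_def desusp_map_def)
  \<comment> \<open>A single desuspension factor has no other factor to pass, so it leaves
    \<open>f 1\<close> unchanged.\<close>
  have F_1: "F 1 = (\<lambda>x. tens scale' [\<phi> x])"
  proof
    fix y
    have "range (\<lambda>x. tens scale' [x]) \<subseteq> tensors scale'" using tens_in_tensors by blast
    from kmap_single_tens[OF V(2) V(2) G(2) linear_tens[OF V(2)] this]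
    show "F 1 y = tens scale' [\<phi> y]" by (simp add: F_def \<phi>[unfolded One_nat_def] desusp_map_def)
  qed

  \<comment> \<open>Since \<open>t\<close> lives in arity 1, only \<open>m = 1\<close> and
    \<open>b = 0\<close> contribute.\<close>
  have dt: "derivation_ext scale (desusp C) \<delta> t n = \<delta> n x" if "n \<ge> 1" for n
  proof -
    have "derivation_ext scale (desusp C) \<delta> t n =
        (\<Sum>m\<in>{1}. \<Sum>b<m. insert_map (desusp C) scale (m - 1 - b) (-1, \<delta> (n - m + 1)) b (t m))"
      unfolding derivation_ext_def
      by (rule sum.mono_neutral_right) (use that in \<open>auto simp: t_def\<close>)
    also have "\<dots> = \<delta> n x"
      using that kmap_single_tens[OF V(1) V(1) D(1) \<delta>_good] by (simp add: t_def)
    finally show ?thesis .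
  qed

  have Ft: "algebra_ext (desusp C) scale' F t n = F n x" if "n \<ge> 1" for n
  proof -
    have "algebra_ext (desusp C) scale' F t n =
        (\<Sum>m\<in>{1}. \<Sum>ks | length ks = m \<and> (\<forall>k\<in>set ks. 1 \<le> k) \<and> sum_list ks = n.
           kmap (desusp C) scale' (map (\<lambda>k. (0, F k)) ks) (t m))"
      unfolding algebra_ext_def
      by (rule sum.mono_neutral_right) (use that in \<open>auto simp: t_def\<close>)
    also have "{ks. length ks = 1 \<and> (\<forall>k\<in>set ks. 1 \<le> k) \<and> sum_list ks = n} = {[n]}"
      using that by (auto simp: length_Suc_conv)
    then have "(\<Sum>m\<in>{1}. \<Sum>ks | length ks = m \<and> (\<forall>k\<in>set ks. 1 \<le> k) \<and> sum_list ks = n.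
        kmap (desusp C) scale' (map (\<lambda>k. (0, F k)) ks) (t m)) = F n x"
      using kmap_single_tens[OF V D(1) F_good[OF that]] by (simp add: t_def)
    finally show ?thesis .
  qed

  \<comment> \<open>By \<open>dt\<close>, the arity \<open>m\<close> part of the differential of
    \<open>t\<close> is \<open>\<delta> m x\<close>, which vanishes for
    \<open>m < N\<close>.\<close>
  have "algebra_ext (desusp C) scale' F (derivation_ext scale (desusp C) \<delta> t) N =
      (\<Sum>m\<in>{N}. \<Sum>ks | length ks = m \<and> (\<forall>k\<in>set ks. 1 \<le> k) \<and> sum_list ks = N.
         kmap (desusp C) scale' (map (\<lambda>k. (0, F k)) ks) (derivation_ext scale (desusp C) \<delta> t m))"
    unfolding algebra_ext_def
    by (rule sum.mono_neutral_right) (use N in \<open>auto simp: dt \<delta>_0\<close>)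
  \<comment> \<open>A composition of \<open>N\<close> into \<open>N\<close> positive parts has all
    parts equal to 1, so only \<open>F 1\<close> occurs.\<close>
  moreover have "{ks. length ks = N \<and> (\<forall>k\<in>set ks. 1 \<le> k) \<and> sum_list ks = N} = {replicate N 1}"
  proof -
    have ge: "length ks \<le> sum_list ks" if "\<forall>k\<in>set ks. 1 \<le> k" for ks :: "nat list"
      using that by (induction ks) auto
    have "ks = replicate (length ks) 1" if "\<forall>k\<in>set ks. 1 \<le> k" "sum_list ks = length ks" for ks :: "nat list"
      using that
    proof (induction ks)
      case (Cons k ks)
      then have "length ks \<le> sum_list ks" "1 \<le> k" using ge by auto
      with Cons show ?case by simp
    qed simp
    then show ?thesis by (auto simp: sum_list_replicate)
  qed
  ultimately have lhs: "algebra_ext (desusp C) scale' F (derivation_ext scale (desusp C) \<delta> t) N =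
      kmap (desusp C) scale' (replicate N (0, \<lambda>x. tens scale' [\<phi> x])) (\<delta> N x)"
    using N by (simp add: dt F_1[unfolded One_nat_def])

  \<comment> \<open>For \<open>2 \<le> m \<le> N\<close> the inserted component has arity
    \<open>N - m + 1\<close>, which is at least 1 and below \<open>N\<close>, where
    \<open>\<delta>'\<close> is zero.\<close>
  have "insert_map (desusp C') scale' (m - 1 - b) (-1, \<delta>' (N - m + 1)) b (F m x) = 0"
    if "m \<in> {1..N} - {1}" for m b
  proof -
    have zero: "0 \<in> tensors scale'" by (rule T'.span_zero)
    from that have m: "1 \<le> N - m + 1" "N - m + 1 < N" "m \<ge> 1" by auto
    have "F m x \<in> tensors scale'" using F_good(2)[OF m(3)] by auto
    then show ?thesis
      unfolding \<delta>_0(2)[OF m(1,2)] using tens_in_tensors[of scale'] zero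
      by (intro kmap_zero_entry[OF V(2) V(2), where d = "-1"]) auto
  qed
  then have "derivation_ext scale' (desusp C') \<delta>' (algebra_ext (desusp C) scale' F t) N =
      (\<Sum>m\<in>{1}. \<Sum>b<m. insert_map (desusp C') scale' (m - 1 - b) (-1, \<delta>' (N - m + 1)) b (F m x))"
    unfolding derivation_ext_def
    by (subst sum.mono_neutral_right[of "{1..N}" "{1}"]) (use N in \<open>auto simp: Ft\<close>)
  also have "\<dots> = \<delta>' N (\<phi> x)"
    using N kmap_single_tens[OF V(2) V(2) D(2) \<delta>'_good] by (simp add: F_1[unfolded One_nat_def])
  finally have rhs: "derivation_ext scale' (desusp C') \<delta>' (algebra_ext (desusp C) scale' F t) N = \<delta>' N (\<phi> x)" .

  interpret K: Vector_Spaces.linear tscale tscale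
    "kmap (desusp C) scale' (replicate N (0, \<lambda>x. tens scale' [\<phi> x]))" by (rule linear_kmap)
  have "algebra_ext (desusp C) scale' F (derivation_ext scale (desusp C) \<delta> t) =
      derivation_ext scale' (desusp C') \<delta>' (algebra_ext (desusp C) scale' F t)"
    using mor t unfolding ainf_morphism_def ainf_differential_def Let_def F_def \<delta>_def \<delta>'_def by blast
  with lhs rhs have "kmap (desusp C) scale' (replicate N (0, \<lambda>x. tens scale' [\<phi> x])) (\<delta> N x) = \<delta>' N (\<phi> x)"
    by metis
  then show ?thesis by (simp add: \<delta>_def \<delta>'_def K.neg)
qed

text \<open>\<open>f 1\<close> takes values in the first tensor power rather than in the target
  space itself. Composing it with the left inverse \<open>h\<close> of
  \<open>y \<mapsto> tens scale' [y]\<close> gives \<open>\<phi>\<close>.\<close>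

lemma ainf_isomorphism_linear_part:
  fixes scale :: "'f::field \<Rightarrow> 'c::ab_group_add \<Rightarrow> 'c" and scale' :: "'f \<Rightarrow> 'd::ab_group_add \<Rightarrow> 'd"
  assumes G: "graded_vector_space scale C" "graded_vector_space scale' C'"
    and iso: "ainf_isomorphism scale C \<Delta> scale' C' \<Delta>' f"
  obtains \<phi> where "\<And>x. f 1 x = tens scale' [\<phi> x]" "Vector_Spaces.linear scale scale' \<phi>" "bij \<phi>"
    "\<And>p x. \<phi> x \<in> C' p \<longleftrightarrow> x \<in> C p"
proof -
  interpret G: graded_vector_space scale C by fact
  interpret G': graded_vector_space scale' C' by fact
  interpret T: vector_space "tscale :: 'f \<Rightarrow> ('f, 'd) tensor \<Rightarrow> _" by (rule vector_space_tscale)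
  have V': "vector_space scale'" ..
  obtain h where h: "Vector_Spaces.linear tscale scale' h" "\<And>x. h (tens scale' [x]) = x"
    using ex_tens_left_inverse[OF V'] by blast
  interpret h: Vector_Spaces.linear tscale scale' h by (rule h)
  interpret tens: Vector_Spaces.linear scale' tscale "\<lambda>x. tens scale' [x]" by (rule linear_tens[OF V'])
  have f: "degree_map scale C scale' C' 1 0 (f 1)" and bij: "bij_betw (f 1) UNIV (tpow scale' 1)"
    using iso by (auto simp: ainf_isomorphism_def ainf_morphism_def dest: spec[of _ 1])
  have eq: "f 1 x = tens scale' [h (f 1 x)]" for x
  proof -
    \<comment> \<open>Every element of the first tensor power is a single tensor, because
      \<open>tens scale' [z]\<close> is linear in \<open>z\<close>.\<close>
    have "t = tens scale' [h t]" if "t \<in> tpow scale' 1" for t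
      using that unfolding tpow_def
    proof (induction rule: T.span_induct_alt)
      case base
      show ?case by (simp only: h.zero tens.zero)
    next
      case (step c x y)
      then obtain z where "x = tens scale' [z]" by (auto simp: length_Suc_conv)
      with step.IH show ?case by (metis h.add h.scale h(2) tens.add tens.scale)
    qed
    then show ?thesis using bij by (auto simp: bij_betw_def)
  qed
  have lin: "Vector_Spaces.linear scale scale' (\<lambda>x. h (f 1 x))"
    using Vector_Spaces.linear_compose[OF _ h(1)] f unfolding degree_map_def o_def by blast
  have inj: "inj (\<lambda>x. h (f 1 x))"
    using bij eq by (metis (mono_tags, lifting) bij_betw_def injD injI)
  have "surj (\<lambda>x. h (f 1 x))"
    unfolding surj_def
  proof
    fix y
    have "tens scale' [y] \<in> range (f 1)"
      using bij tens_in_tpow[of scale' "[y]"] by (simp add: bij_betw_def)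
    then show "\<exists>x. y = h (f 1 x)" using h(2) by (metis rangeE)
  qed
  with inj have "bij (\<lambda>x. h (f 1 x))" by (simp add: bij_def)
  moreover have "h (f 1 x) \<in> C' p" if "x \<in> C p" for x p
  proof -
    have "f 1 x \<in> tpow_deg scale' C' 1 p" using f that by (force simp: degree_map_def)
    then show ?thesis unfolding tpow_deg_def
    proof (induction rule: T.span_induct_alt)
      case base
      show ?case by (simp only: h.zero G'.subspace_0[OF G'.subspace_deg])
    next
      case (step c x y)
      then have "h x \<in> C' p"
        by (auto simp: length_Suc_conv list_all2_Cons1 h(2))
      then show ?case
        unfolding h.add h.scale by (intro G'.subspace_add G'.subspace_scale G'.subspace_deg step.IH)
    qed
  qed
  ultimately show ?thesis
    using that[of "\<lambda>x. h (f 1 x)"] eq lin graded_bij_deg_iff[OF G lin inj] by blast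
qed

text \<open>This turns bounds on the leading arity into vanishing conditions, treating finite and
  infinite values alike, which is the form needed for induction.\<close>

lemma first_nonzero_le_iff:
  "enat N \<le> first_nonzero \<Delta> \<longleftrightarrow> (\<forall>n. 1 \<le> n \<longrightarrow> n < N \<longrightarrow> \<Delta> n = (\<lambda>x. 0))"
proof (cases "\<exists>n\<ge>1. \<Delta> n \<noteq> (\<lambda>x. 0)")
  case True
  define L where "L = (LEAST n. n \<ge> 1 \<and> \<Delta> n \<noteq> (\<lambda>x. 0))"
  have L: "L \<ge> 1" "\<Delta> L \<noteq> (\<lambda>x. 0)"
    unfolding atomize_conj L_def using True by (rule LeastI_ex)
  have least: "L \<le> n" if "n \<ge> 1" "\<Delta> n \<noteq> (\<lambda>x. 0)" for n
    unfolding L_def by (rule Least_le) (use that in blast)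
  have "N \<le> L \<longleftrightarrow> (\<forall>n. 1 \<le> n \<longrightarrow> n < N \<longrightarrow> \<Delta> n = (\<lambda>x. 0))"
    using L least by (meson leD le_less_linear order_less_le_trans)
  moreover have "first_nonzero \<Delta> = enat L"
    using True by (simp add: first_nonzero_def L_def)
  ultimately show ?thesis by simp
next
  case False
  then have "first_nonzero \<Delta> = \<infinity>" by (auto simp: first_nonzero_def)
  with False show ?thesis by auto
qed

theorem theorem3p2:
  fixes scale :: "'f::field \<Rightarrow> 'c::ab_group_add \<Rightarrow> 'c"
    and C :: "int \<Rightarrow> 'c set"
    and \<Delta> \<Delta>' :: "nat \<Rightarrow> 'c \<Rightarrow> ('f, 'c) tensor"
  assumes "graded_vector_space scale C"
    and "\<And>p. p < 0 \<Longrightarrow> C p = {0}"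
    and "ainf_coalgebra scale C \<Delta>" and "minimal \<Delta>"
    and "ainf_coalgebra scale C \<Delta>'" and "minimal \<Delta>'"
    and "ainf_isomorphic scale C \<Delta> scale C \<Delta>'"
  shows "first_nonzero \<Delta> = first_nonzero \<Delta>' \<and>
    (\<forall>m\<ge>1. enat m \<le> first_nonzero \<Delta> \<longrightarrow> (\<forall>p\<ge>0.
      (cdim scale {x \<in> C p. \<Delta> m x = 0}, cdim scale {x \<in> C p. \<Delta>' m x = 0}) \<in> ordIso))"
proof -
  note G = assms(1)
  interpret G: graded_vector_space scale C by fact
  have V: "vector_space scale" ..
  obtain f where f: "ainf_isomorphism scale C \<Delta> scale C \<Delta>' f"
    using assms(7) by (auto simp: ainf_isomorphic_def)
  obtain \<phi> where \<phi>: "\<And>x. f 1 x = tens scale [\<phi> x]" "Vector_Spaces.linear scale scale \<phi>" "bij \<phi>"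
    and \<phi>_deg: "\<And>p x. \<phi> x \<in> C p \<longleftrightarrow> x \<in> C p"
    using ainf_isomorphism_linear_part[OF G G f] by blast
  have \<Delta>: "degree_map scale C scale C n (int n - 2) (\<Delta> n)"
    and \<Delta>': "degree_map scale C scale C n (int n - 2) (\<Delta>' n)" if "n \<ge> 1" for n
    using assms(3,5) that by (simp_all add: ainf_coalgebra_def)
  have mor: "ainf_morphism scale C \<Delta> scale C \<Delta>' f" using f by (simp add: ainf_isomorphism_def)

  have kernel: "\<Delta> N x = 0 \<longleftrightarrow> \<Delta>' N (\<phi> x) = 0"
    if N: "N \<ge> 1" and below: "\<And>n. 1 \<le> n \<Longrightarrow> n < N \<Longrightarrow> \<Delta> n = (\<lambda>x. 0) \<and> \<Delta>' n = (\<lambda>x. 0)"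
      and x: "x \<in> C q" for N x q
  proof -
    \<comment> \<open>Injectivity of desuspension and of the tensor power of \<open>\<phi>\<close>
      is known only on the \<open>N\<close>-th tensor power.\<close>
    note mem = degree_map_in_tpow[OF G \<Delta>[OF N], of x] degree_map_in_tpow[OF G \<Delta>'[OF N], of "\<phi> x"]
    have "\<Delta> N x = 0 \<longleftrightarrow>
        kmap (desusp C) scale (replicate N (0, \<lambda>x. tens scale [\<phi> x])) (desusp_map C scale N (\<Delta> N x)) = 0"
      using kmap_bij_eq_0_iff[OF graded_vector_space_desusp[OF G] G \<phi>(2,3) desusp_map_in_tpow[OF G mem(1)]]
        desusp_map_eq_0_iff[OF G mem(1)] by simp
    also have "\<dots> \<longleftrightarrow> desusp_map C scale N (\<Delta>' N (\<phi> x)) = 0"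
      using morphism_leading_term[of scale C scale C \<Delta> \<Delta>' f \<phi> N x q] G \<Delta> \<Delta>' mor \<phi>(1) N below x by simp
    also have "\<dots> \<longleftrightarrow> \<Delta>' N (\<phi> x) = 0"
      by (rule desusp_map_eq_0_iff[OF G mem(2)])
    finally show ?thesis .
  qed

  \<comment> \<open>Vanishing may be tested on homogeneous vectors, and \<open>\<phi>\<close> maps
    each \<open>C p\<close> onto itself.\<close>
  have zero_iff: "\<Delta> N = (\<lambda>x. 0) \<longleftrightarrow> \<Delta>' N = (\<lambda>x. 0)"
    if N: "N \<ge> 1" and below: "\<And>n. 1 \<le> n \<Longrightarrow> n < N \<Longrightarrow> \<Delta> n = (\<lambda>x. 0) \<and> \<Delta>' n = (\<lambda>x. 0)" for N
  proof -
    have lin: "Vector_Spaces.linear scale tscale (\<Delta> N)" "Vector_Spaces.linear scale tscale (\<Delta>' N)"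
      using \<Delta>[OF N] \<Delta>'[OF N] by (simp_all add: degree_map_def)
    have "(\<forall>p. \<forall>x\<in>C p. \<Delta> N x = 0) \<longleftrightarrow> (\<forall>p. \<forall>x\<in>C p. \<Delta>' N (\<phi> x) = 0)"
      using kernel[OF that] by blast
    also have "\<dots> \<longleftrightarrow> (\<forall>p. \<forall>y\<in>C p. \<Delta>' N y = 0)"
      using \<phi>_deg bij_is_surj[OF \<phi>(3)] by (metis surjD)
    finally show ?thesis
      using G.linear_eq_0_on_homogeneous[OF lin(1)] G.linear_eq_0_on_homogeneous[OF lin(2)]
      by (metis ext)
  qed
  have le_iff: "enat N \<le> first_nonzero \<Delta> \<longleftrightarrow> enat N \<le> first_nonzero \<Delta>'" for N
  proof (induction N)
    case 0
    show ?case by (simp add: zero_enat_def[symmetric])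
  next
    case (Suc N)
    show ?case
    proof (cases "N \<ge> 1 \<and> enat N \<le> first_nonzero \<Delta>")
      \<comment> \<open>Both families vanish below \<open>N\<close> by the induction hypothesis, so
        \<open>zero_iff\<close> settles the one new condition, at arity \<open>N\<close>.\<close>
      case True
      with Suc zero_iff[of N] show ?thesis
        unfolding first_nonzero_le_iff by (auto simp: less_Suc_eq)
    next
      \<comment> \<open>If \<open>N = 0\<close>, the bound by 1 holds vacuously for both families.
        Otherwise the bound by \<open>N\<close>, and hence by \<open>Suc N\<close>, fails for
        both.\<close>
      case False
      then show ?thesis
        using Suc unfolding first_nonzero_le_iff by (auto simp: less_Suc_eq Suc_le_eq)
    qed
  qed
  have eq: "first_nonzero \<Delta> = first_nonzero \<Delta>'"
  proof -
    \<comment> \<open>An extended natural number is determined by the natural numbers below or equal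
      to it.\<close>
    have "x \<le> y" if "\<And>N. enat N \<le> x \<Longrightarrow> enat N \<le> y" for x y
      using that by (cases x; cases y) (auto, metis Suc_n_not_le_n)
    with le_iff show ?thesis by (blast intro: antisym)
  qed
  \<comment> \<open>For \<open>m\<close> up to the common leading arity, both families vanish below
    \<open>m\<close>. Thus \<open>kernel\<close> applies at \<open>m\<close> itself and
    \<open>\<phi>\<close> maps one kernel in degree \<open>p\<close> onto the other.\<close>
  have "(cdim scale {x \<in> C p. \<Delta> m x = 0}, cdim scale {x \<in> C p. \<Delta>' m x = 0}) \<in> ordIso"
    if m: "m \<ge> 1" "enat m \<le> first_nonzero \<Delta>" for m p
  proof (rule cdim_ordIso[OF V V \<phi>(2) bij_is_inj[OF \<phi>(3)]])
    interpret \<Delta>: Vector_Spaces.linear scale tscale "\<Delta> m" using \<Delta>[OF m(1)] by (simp add: degree_map_def)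
    show "G.subspace {x \<in> C p. \<Delta> m x = 0}"
      using G.subspace_inter[OF G.subspace_deg[of p] \<Delta>.subspace_kernel] by (simp add: Int_def)
    have "\<Delta> m x = 0 \<longleftrightarrow> \<Delta>' m (\<phi> x) = 0" if "x \<in> C p" for x
      using m eq first_nonzero_le_iff[of m \<Delta>] first_nonzero_le_iff[of m \<Delta>'] that
      by (intro kernel[of m x p]) auto
    then show "{x \<in> C p. \<Delta>' m x = 0} = \<phi> ` {x \<in> C p. \<Delta> m x = 0}"
      using \<phi>_deg bij_is_surj[OF \<phi>(3)] by (auto simp: image_iff) (metis surjD)
  qed
  with eq show ?thesis by blast
qed

end
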